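(* Let $G$ be an irreducible algebraic group defined over $\mathbb{R}$, $X\subset\mathbb{C}^d$ a Zariski closed set defined over $\mathbb{R}$, $x\in X(\mathbb{R})$, and $G\times X\to X$ a polynomial action defined over $\mathbb{R}$. Denote by $Y$ the Zariski closure of $G\cdot x$ in $X$. Then the map $$G(\mathbb{R})\to Y(\mathbb{R}):\ g\mapsto g\cdot x$$ is open with respect to the Euclidean topology.
   Context: An algebraic group is a subgroup $G$ of $\mathrm{GL}_n(\mathbb{C})$ (for some $n$) which is the set of $g\in\mathrm{GL}_n(\mathbb{C})$ at which all polynomials in some subset of $\mathbb{C}[x_{11},\ldots,x_{nn}]$ vanish. Zariski closed subsets of $\mathbb{C}^d$ are the common zero sets of families of polynomials. A Zariski closed set $Z$ is irreducible if $Z\ne Z_1\cup Z_2$ for any closed $Z_1,Z_2\subsetneq Z$ (for an algebraic group, closed in the Zariski topology induced on $G$). For a set $Z$, $\mathcal{I}(Z)$ is the ideal of polynomials vanishing on $Z$; $Z$ is defined over $\mathbb{R}$ if $\mathcal{I}(Z)$ is generated by polynomials with real coefficients. For $Z\subset\mathbb{C}^d$, $Z(\mathbb{R})=Z\cap\mathbb{R}^d$; $G(\mathbb{R})=G\cap\mathrm{GL}_n(\mathbb{R})$. A polynomial action defined over $\mathbb{R}$ is a group action $G\times X\to X$ given by a polynomial map with real coefficients. *)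

theory Defs
  imports
    "HOL-Analysis.Analysis"
    "HOL-Library.Poly_Mapping"
    "HOL-Algebra.Group_Action"
begin

section \<open>Polynomials in finitely many variables\<close>

text \<open>
  The polynomial ring with complex coefficients and variables indexed by \<open>'v\<close>: a polynomial maps
  each exponent vector (finitely supported \<open>'v \<Rightarrow> nat\<close>) to its coefficient. The ring structure,
  with convolution as multiplication, is the one of \<open>HOL-Library.Poly_Mapping\<close>.
\<close>

type_synonym 'v cpoly = "('v \<Rightarrow>\<^sub>0 nat) \<Rightarrow>\<^sub>0 complex"

definition monom_eval :: "('v \<Rightarrow>\<^sub>0 nat) \<Rightarrow> ('v \<Rightarrow> complex) \<Rightarrow> complex" where
  "monom_eval m z = (\<Prod>v\<in>Poly_Mapping.keys m. z v ^ Poly_Mapping.lookup m v)"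

definition peval :: "'v cpoly \<Rightarrow> ('v \<Rightarrow> complex) \<Rightarrow> complex" where
  "peval p z = (\<Sum>m\<in>Poly_Mapping.keys p. Poly_Mapping.lookup p m * monom_eval m z)"

definition real_cpoly :: "'v cpoly \<Rightarrow> bool" where
  "real_cpoly p \<longleftrightarrow> (\<forall>m. Poly_Mapping.lookup p m \<in> \<real>)"

lemma monom_eval_superset:
  assumes "finite A" "Poly_Mapping.keys m \<subseteq> A"
  shows "monom_eval m z = (\<Prod>v\<in>A. z v ^ Poly_Mapping.lookup m v)"
  unfolding monom_eval_def
  by (rule prod.mono_neutral_left) (use assms in \<open>auto simp: in_keys_iff\<close>)

lemma monom_eval_zero [simp]: "monom_eval 0 z = 1"
  by (simp add: monom_eval_def)

lemma monom_eval_add: "monom_eval (m + n) z = monom_eval m z * monom_eval n z"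
proof -
  let ?A = "Poly_Mapping.keys m \<union> Poly_Mapping.keys n"
  have "monom_eval (m + n) z = (\<Prod>v\<in>?A. z v ^ Poly_Mapping.lookup (m + n) v)"
    by (intro monom_eval_superset) (simp_all add: Poly_Mapping.keys_add)
  also have "\<dots> = (\<Prod>v\<in>?A. z v ^ Poly_Mapping.lookup m v) *
      (\<Prod>v\<in>?A. z v ^ Poly_Mapping.lookup n v)"
    by (simp add: lookup_add power_add prod.distrib)
  also have "\<dots> = monom_eval m z * monom_eval n z"
    by (simp add: monom_eval_superset[of ?A])
  finally show ?thesis .
qed

lemma peval_superset:
  assumes "finite A" "Poly_Mapping.keys p \<subseteq> A"
  shows "peval p z = (\<Sum>m\<in>A. Poly_Mapping.lookup p m * monom_eval m z)"
  unfolding peval_def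
  by (rule sum.mono_neutral_left) (use assms in \<open>auto simp: in_keys_iff\<close>)

lemma peval_zero [simp]: "peval 0 z = 0"
  by (simp add: peval_def)

lemma peval_single [simp]: "peval (Poly_Mapping.single m c) z = c * monom_eval m z"
  by (simp add: peval_superset[of "{m}"])

lemma peval_one [simp]: "peval 1 z = 1"
  using peval_single[of 0 1 z] by simp

lemma peval_add: "peval (p + q) z = peval p z + peval q z"
proof -
  let ?A = "Poly_Mapping.keys p \<union> Poly_Mapping.keys q"
  have "peval (p + q) z = (\<Sum>m\<in>?A. Poly_Mapping.lookup (p + q) m * monom_eval m z)"
    by (intro peval_superset) (simp_all add: Poly_Mapping.keys_add)
  then show ?thesis
    by (simp add: lookup_add distrib_right sum.distrib peval_superset[of ?A])
qed

lemma cpoly_induct [case_names zero add]: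
  fixes p :: "'v cpoly"
  assumes "P 0" and "\<And>p m c. P p \<Longrightarrow> P (p + Poly_Mapping.single m c)"
  shows "P p"
proof (induction p rule: update_induct)
  case const
  then show ?case using assms(1) by simp
next
  case (update p m c)
  then have "Poly_Mapping.update m c p = p + Poly_Mapping.single m c"
    by (intro poly_mapping_eqI) (auto simp: lookup_update lookup_add lookup_single in_keys_iff)
  then show ?case using assms(2) update by simp
qed

lemma peval_mult: "peval (p * q) z = peval p z * peval q z"
proof (induction p rule: cpoly_induct)
  case (add p m c)
  have "peval (Poly_Mapping.single m c * q) z = c * monom_eval m z * peval q z"
    by (induction q rule: cpoly_induct)
       (simp_all add: distrib_left peval_add mult_single monom_eval_add mult_ac)
  then show ?case
    using add by (simp add: distrib_right peval_add)
qed simp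

section \<open>The Zariski topology\<close>

definition zero_set :: "'v cpoly set \<Rightarrow> (complex^'v::finite) set" where
  "zero_set S = {z. \<forall>p\<in>S. peval p (($) z) = 0}"

definition zariski_closed :: "(complex^'v::finite) set \<Rightarrow> bool" where
  "zariski_closed Z \<longleftrightarrow> (\<exists>S. Z = zero_set S)"

definition zariski_topology :: "(complex^'v::finite) topology" where
  "zariski_topology = topology (\<lambda>U. zariski_closed (- U))"

lemma istopology_zariski: "istopology (\<lambda>U :: (complex^'v::finite) set. zariski_closed (- U))"
  unfolding istopology_def
proof (intro conjI allI impI)
  fix U V :: "(complex^'v) set"
  assume "zariski_closed (- U)" "zariski_closed (- V)"
  then obtain S T where ST: "- U = zero_set S" "- V = zero_set T"
    by (auto simp: zariski_closed_def)
  have "- (U \<inter> V) = zero_set {p * q | p q. p \<in> S \<and> q \<in> T}"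
    unfolding Compl_Int ST by (fastforce simp: zero_set_def peval_mult)
  then show "zariski_closed (- (U \<inter> V))"
    by (auto simp: zariski_closed_def)
next
  fix \<K> :: "(complex^'v) set set"
  assume "\<forall>K\<in>\<K>. zariski_closed (- K)"
  then obtain S where S: "\<And>K. K \<in> \<K> \<Longrightarrow> - K = zero_set (S K)"
    unfolding zariski_closed_def by metis
  have "- \<Union>\<K> = (\<Inter>K\<in>\<K>. - K)"
    by blast
  also have "\<dots> = zero_set (\<Union>K\<in>\<K>. S K)"
    using S by (auto simp: zero_set_def)
  finally show "zariski_closed (- \<Union>\<K>)"
    by (auto simp: zariski_closed_def)
qed

lemma openin_zariski: "openin zariski_topology U \<longleftrightarrow> zariski_closed (- U)"
  by (simp add: zariski_topology_def topology_inverse'[OF istopology_zariski])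

lemma topspace_zariski [simp]: "topspace zariski_topology = UNIV"
proof -
  have "- UNIV = zero_set {1}"
    by (simp add: zero_set_def)
  then have "openin zariski_topology UNIV"
    by (auto simp: openin_zariski zariski_closed_def)
  then show ?thesis
    using openin_subset by blast
qed

lemma closedin_zariski: "closedin zariski_topology Z \<longleftrightarrow> zariski_closed Z"
  by (simp add: closedin_def openin_zariski flip: Compl_eq_Diff_UNIV)

definition zariski_irreducible :: "(complex^'v::finite) set \<Rightarrow> bool" where
  "zariski_irreducible Z \<longleftrightarrow>
     \<not> (\<exists>Z1 Z2. closedin (subtopology zariski_topology Z) Z1 \<and> Z1 \<subset> Z \<and>
               closedin (subtopology zariski_topology Z) Z2 \<and> Z2 \<subset> Z \<and> Z = Z1 \<union> Z2)"

section \<open>Real structures\<close>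

definition vanishing_ideal :: "(complex^'v::finite) set \<Rightarrow> 'v cpoly set" where
  "vanishing_ideal Z = {p. \<forall>z\<in>Z. peval p (($) z) = 0}"

text \<open>Regarding a commutative ring as a module over itself, \<open>module.span (*) B\<close> is the ideal
  generated by \<open>B\<close>.\<close>

lemma module_cpoly: "module ((*) :: 'v cpoly \<Rightarrow> 'v cpoly \<Rightarrow> 'v cpoly)"
  by unfold_locales (simp_all add: algebra_simps)

definition defined_over_reals :: "(complex^'v::finite) set \<Rightarrow> bool" where
  "defined_over_reals Z \<longleftrightarrow>
     (\<exists>B. (\<forall>p\<in>B. real_cpoly p) \<and> vanishing_ideal Z = module.span (*) B)"

definition real_points :: "(complex^'v::finite) set \<Rightarrow> (complex^'v) set" where
  "real_points Z = {z \<in> Z. \<forall>i. z $ i \<in> \<real>}"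

section \<open>Algebraic groups and their polynomial actions\<close>

definition GL :: "(complex^'n::finite^'n) monoid" where
  "GL = \<lparr>carrier = {g. invertible g}, mult = (**), one = mat 1\<rparr>"

lemma group_GL: "group (GL :: (complex^'n::finite^'n) monoid)"
proof (rule groupI)
  fix g :: "complex^'n^'n"
  assume "g \<in> carrier GL"
  then show "\<exists>h\<in>carrier GL. h \<otimes>\<^bsub>GL\<^esub> g = \<one>\<^bsub>GL\<^esub>"
    by (auto simp: GL_def invertible_def)
qed (auto simp: GL_def invertible_mult matrix_mul_assoc invertible_def[of "mat 1"])

text \<open>The coordinates identifying \<open>n \<times> n\<close> matrices with points of affine \<open>n\<^sup>2\<close>-space.\<close>

definition entries :: "complex^'n::finite^'n \<Rightarrow> complex^('n \<times> 'n)" where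
  "entries g = (\<chi> ij. g $ fst ij $ snd ij)"

definition algebraic_group :: "(complex^'n::finite^'n) set \<Rightarrow> bool" where
  "algebraic_group G \<longleftrightarrow>
     subgroup G GL \<and> (\<exists>S. G = {g \<in> carrier GL. entries g \<in> zero_set S})"

definition real_matrices :: "(complex^'n::finite^'n) set \<Rightarrow> (complex^'n^'n) set" where
  "real_matrices G = {g \<in> G. \<forall>i j. g $ i $ j \<in> \<real>}"

text \<open>
  The polynomials giving the action live in the variables \<open>('n \<times> 'n) + 'd\<close>: the matrix entries
  followed by the coordinates of the point acted upon. The locale \<open>group_action\<close> requires each
  \<open>act g\<close> to be extensional on \<open>X\<close>, so that \<open>act\<close> carries only the data of a map \<open>G \<times> X \<rightarrow> X\<close>.
\<close>

definition real_polynomial_action ::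
  "(complex^'n::finite^'n) set \<Rightarrow> (complex^'d::finite) set \<Rightarrow>
   (complex^'n^'n \<Rightarrow> complex^'d \<Rightarrow> complex^'d) \<Rightarrow> bool" where
  "real_polynomial_action G X act \<longleftrightarrow>
     group_action (GL\<lparr>carrier := G\<rparr>) X act \<and>
     (\<exists>P :: 'd \<Rightarrow> (('n \<times> 'n) + 'd) cpoly.
        (\<forall>k. real_cpoly (P k)) \<and>
        (\<forall>g\<in>G. \<forall>y\<in>X. \<forall>k. act g y $ k = peval (P k) (case_sum (($) (entries g)) (($) y))))"

end

theory Submission
  imports Defs
    "HOL-Complex_Analysis.Complex_Analysis"
    "HOL-Computational_Algebra.Fundamental_Theorem_Algebra"
begin

text \<open>
The group \<open>G(\<real>)\<close> acts on \<open>Y(\<real>)\<close> by homeomorphisms and the orbit map is equivariant, so it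
is enough to find, for each neighbourhood \<open>U\<close> of the identity in \<open>G(\<real>)\<close>, a neighbourhood of \<open>x\<close>
in \<open>Y(\<real>)\<close> that is contained in \<open>U \<cdot> x\<close>. This is an inverse function argument once the
differential of the orbit map, from the tangent space of \<open>G\<close> at the identity to the Zariski tangent
space of \<open>Y\<close> at \<open>x\<close>, is known to be surjective. That surjectivity is where characteristic zero
enters: in positive characteristic a dominant map can have vanishing differential.

Surjectivity is proved at a generic point. Let \<open>K\<close> be a countable subring of \<open>\<complex>\<close> that contains the
coefficients of all polynomials involved, and let \<open>\<xi> \<in> G\<close> be a point such that every polynomial over
\<open>K\<close> that vanishes at \<open>\<xi>\<close> vanishes on \<open>G\<close>. Such a point exists because the ideal of \<open>G\<close> is prime
and \<open>\<complex>\<close> is algebraically closed and uncountable (\<open>countable_nullstellensatz\<close>,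
\<open>generic_point_exists\<close>). A vector \<open>w\<close> tangent to \<open>Y\<close> at \<open>\<xi> \<cdot> x\<close> defines a \<open>K\<close>-derivation of
the ring \<open>K[\<xi> \<cdot> x]\<close> that maps \<open>p(\<xi> \<cdot> x)\<close> to the derivative of \<open>p\<close> in direction \<open>w\<close>; it is
well defined because a relation over \<open>K\<close> that holds at the generic point of the orbit holds on all of
\<open>Y\<close>. Derivations extend along ring extensions in characteristic zero (\<open>derivation_on_adjoin\<close>), and
the values of an extension on the entries of \<open>\<xi>\<close> form a tangent vector of \<open>G\<close> at \<open>\<xi>\<close> lying over \<open>w\<close>
(\<open>tangent_lift\<close>). Translating by \<open>\<xi>\<close> moves the result to the identity
(\<open>orbit_differential_surj\<close>), and since the vanishing ideals of \<open>G\<close> and \<open>Y\<close> are stable under complex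
conjugation, taking real parts gives the statement for real tangent vectors
(\<open>real_orbit_differential_surj\<close>).

A real tangent vector \<open>A\<close> of \<open>G\<close> at the identity integrates to the curve \<open>exp(tA)\<close> in \<open>G(\<real>)\<close>,
because the derivation of the coordinate ring given by the left invariant vector field of \<open>A\<close>
preserves the ideal of \<open>G\<close> (\<open>exponential_in_zero_set\<close>). Products of such curves give a differentiable
map from a neighbourhood of \<open>0\<close> in \<open>\<real>\<^sup>d\<close> to \<open>Y(\<real>)\<close> whose differential at \<open>0\<close> is a projection
onto the real tangent space \<open>T\<close> of \<open>Y\<close> at \<open>x\<close>. On the other hand projecting \<open>Y(\<real>)\<close> to \<open>T\<close> is
injective near \<open>x\<close>, because suitable equations of \<open>Y\<close> supply the missing coordinates. So the points of
the orbit cover the image of \<open>Y(\<real>)\<close> in \<open>T\<close> near \<open>x\<close>, hence \<open>Y(\<real>)\<close> itself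
(\<open>orbit_map_locally_open\<close>).
\<close>

unbundle no fps_syntax

section \<open>Polynomials with coefficients in a subring\<close>

abbreviation cconst :: "complex \<Rightarrow> 'v cpoly" where
  "cconst c \<equiv> Poly_Mapping.single 0 c"

abbreviation cvar :: "'v \<Rightarrow> 'v cpoly" where
  "cvar v \<equiv> Poly_Mapping.single (Poly_Mapping.single v (Suc 0)) 1"

text \<open>
Tracking coefficients is what makes it possible to speak of points that are generic over a countable
ring of constants.
\<close>
definition coeffs_in :: "complex set \<Rightarrow> 'v cpoly \<Rightarrow> bool" where
  "coeffs_in K p \<longleftrightarrow> range (Poly_Mapping.lookup p) \<subseteq> K"

definition unital_subring :: "'a::comm_ring_1 set \<Rightarrow> bool" where
  "unital_subring K \<longleftrightarrow> 1 \<in> K \<and> (\<forall>a\<in>K. \<forall>b\<in>K. a - b \<in> K \<and> a * b \<in> K)"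

lemma unital_subringD:
  assumes "unital_subring K"
  shows "0 \<in> K" "1 \<in> K"
    and "a \<in> K \<Longrightarrow> b \<in> K \<Longrightarrow> a + b \<in> K"
    and "a \<in> K \<Longrightarrow> b \<in> K \<Longrightarrow> a - b \<in> K"
    and "a \<in> K \<Longrightarrow> b \<in> K \<Longrightarrow> a * b \<in> K"
    and "a \<in> K \<Longrightarrow> - a \<in> K"
proof -
  have K: "1 \<in> K" "\<And>a b. a \<in> K \<Longrightarrow> b \<in> K \<Longrightarrow> a - b \<in> K" "\<And>a b. a \<in> K \<Longrightarrow> b \<in> K \<Longrightarrow> a * b \<in> K"
    using assms by (auto simp: unital_subring_def)
  show 0: "0 \<in> K"
    using K(1) K(2)[of 1 1] by simp
  show neg: "- a \<in> K" if "a \<in> K" for a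
    using K(2)[OF 0 that] by simp
  show "a \<in> K \<Longrightarrow> b \<in> K \<Longrightarrow> a + b \<in> K"
    using K(2)[of a "- b"] neg[of b] by simp
qed (use assms in \<open>auto simp: unital_subring_def\<close>)

lemma unital_subring_sum:
  "unital_subring K \<Longrightarrow> (\<And>i. i \<in> A \<Longrightarrow> f i \<in> K) \<Longrightarrow> sum f A \<in> K"
  by (induction A rule: infinite_finite_induct) (auto intro: unital_subringD)

lemma monom_eval_var [simp]: "monom_eval (Poly_Mapping.single v (Suc 0)) z = z v"
  by (simp add: monom_eval_def)

lemma peval_cvar: "peval (cvar v) z = z v"
  by simp

lemma coeffs_in_induct [consumes 2, case_names zero add]:
  fixes p :: "'v cpoly"
  assumes "coeffs_in K p" and "0 \<in> K" and "P 0"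
    and step: "\<And>p m c. coeffs_in K p \<Longrightarrow> c \<in> K \<Longrightarrow> P p \<Longrightarrow> P (p + Poly_Mapping.single m c)"
  shows "P p"
  using assms(1)
proof (induction p rule: update_induct)
  case const
  then show ?case using assms(3) by simp
next
  case (update p m c)
  have eq: "Poly_Mapping.update m c p = p + Poly_Mapping.single m c"
    using update(1,2) by (intro poly_mapping_eqI)
      (auto simp: lookup_update lookup_add lookup_single in_keys_iff)
  have in_K: "Poly_Mapping.lookup (Poly_Mapping.update m c p) n \<in> K" for n
    using update(4) by (auto simp: coeffs_in_def)
  have "c \<in> K"
    using in_K[of m] by (simp add: lookup_update)
  moreover have "coeffs_in K p"
    unfolding coeffs_in_def
  proof safe
    fix n
    show "Poly_Mapping.lookup p n \<in> K"
      using in_K[of n] assms(2) update(1) by (cases "n = m") (auto simp: lookup_update in_keys_iff)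
  qed
  ultimately show ?case
    unfolding eq using update(3) by (intro step) auto
qed

text \<open>
Polynomials over a subring are generated from constants and variables by sums and products, so facts
about them can be proved without ever looking at monomials.
\<close>
lemma cpoly_generated_induct [consumes 2, case_names const var add mult]:
  fixes p :: "'v cpoly"
  assumes "coeffs_in K p" and K: "unital_subring K"
    and const: "\<And>c. c \<in> K \<Longrightarrow> P (cconst c)"
    and var: "\<And>v. P (cvar v)"
    and add: "\<And>p q. P p \<Longrightarrow> P q \<Longrightarrow> P (p + q)"
    and mult: "\<And>p q. P p \<Longrightarrow> P q \<Longrightarrow> P (p * q)"
  shows "P p"
proof -
  have one: "P 1"
    using const[of 1] unital_subringD(2)[OF K] by simp
  have power: "P (Poly_Mapping.single (Poly_Mapping.single v n) 1)" for v :: 'v and n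
  proof (induction n)
    case 0
    then show ?case using one by simp
  next
    case (Suc n)
    have "Poly_Mapping.single (Poly_Mapping.single v (Suc n)) 1 =
        Poly_Mapping.single (Poly_Mapping.single v n) (1::complex) * cvar v"
      by (simp add: mult_single flip: single_add)
    then show ?case using mult[OF Suc var] by simp
  qed
  have monom: "P (Poly_Mapping.single m 1)" for m :: "'v \<Rightarrow>\<^sub>0 nat"
  proof (induction m rule: update_induct)
    case const
    then show ?case using one by simp
  next
    case (update m v n)
    have "Poly_Mapping.update v n m = m + Poly_Mapping.single v n"
      using update by (intro poly_mapping_eqI)
        (auto simp: lookup_update lookup_add lookup_single in_keys_iff)
    then have "Poly_Mapping.single (Poly_Mapping.update v n m) 1 =
        Poly_Mapping.single m (1::complex) * Poly_Mapping.single (Poly_Mapping.single v n) 1"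
      by (simp add: mult_single)
    then show ?case using mult[OF update(3) power] by simp
  qed
  show ?thesis
    using assms(1) unital_subringD(1)[OF K]
  proof (induction p rule: coeffs_in_induct)
    case zero
    then show ?case using const[of 0] unital_subringD(1)[OF K] by simp
  next
    case (add p m c)
    have "Poly_Mapping.single m c = cconst c * Poly_Mapping.single m 1"
      by (simp add: mult_single)
    then show ?case
      using add by (auto intro: assms(5,6) const monom)
  qed
qed

lemma unital_subring_UNIV: "unital_subring UNIV"
  by (simp add: unital_subring_def)

lemmas cpoly_generated_induct_UNIV [case_names const var add mult] =
  cpoly_generated_induct[OF _ unital_subring_UNIV, unfolded coeffs_in_def, simplified]

lemma coeffs_in_closure:
  fixes p q :: "'v cpoly"
  assumes K: "unital_subring K"
  shows "c \<in> K \<Longrightarrow> coeffs_in K (cconst c :: 'v cpoly)" "coeffs_in K (cvar v)"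
    and "coeffs_in K p \<Longrightarrow> coeffs_in K q \<Longrightarrow> coeffs_in K (p + q)"
    and "coeffs_in K p \<Longrightarrow> coeffs_in K q \<Longrightarrow> coeffs_in K (p * q)"
proof -
  note D = unital_subringD[OF K]
  show "c \<in> K \<Longrightarrow> coeffs_in K (cconst c :: 'v cpoly)" "coeffs_in K (cvar v)"
    using D(1,2) by (auto simp: coeffs_in_def lookup_single when_def)
  have sum: "coeffs_in K (p + q)" if "coeffs_in K p" "coeffs_in K q" for p q :: "'v cpoly"
    using that D(3) by (auto simp: coeffs_in_def lookup_add image_subset_iff)
  then show "coeffs_in K p \<Longrightarrow> coeffs_in K q \<Longrightarrow> coeffs_in K (p + q)" .
  have single: "coeffs_in K (Poly_Mapping.single m c * q)" if "c \<in> K" "coeffs_in K q"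
    for m c and q :: "'v cpoly"
    using that(2) D(1)
  proof (induction q rule: coeffs_in_induct)
    case zero
    then show ?case using D(1) by (simp add: coeffs_in_def)
  next
    case (add q m' c')
    have "coeffs_in K (Poly_Mapping.single (m + m') (c * c'))"
      using D(1) D(5)[OF that(1) add(2)] by (auto simp: coeffs_in_def lookup_single when_def)
    then show ?case
      using add by (auto simp: distrib_left mult_single intro: sum)
  qed
  show "coeffs_in K (p * q)" if "coeffs_in K p" and q: "coeffs_in K q"
    using that(1) D(1)
  proof (induction p rule: coeffs_in_induct)
    case zero
    then show ?case using D(1) by (simp add: coeffs_in_def)
  next
    case (add p m c)
    then show ?case
      using single[OF _ q] by (auto simp: distrib_right intro: sum)
  qed
qed

lemma subst_exists:
  fixes p :: "'v cpoly" and Q :: "'v \<Rightarrow> 'u cpoly"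
  assumes "coeffs_in K p" "unital_subring K" "\<And>v. coeffs_in K (Q v)"
  shows "\<exists>r. coeffs_in K r \<and> (\<forall>z. peval r z = peval p (\<lambda>v. peval (Q v) z))"
  using assms(1,2)
proof (induction p rule: cpoly_generated_induct)
  case (const c)
  then show ?case
    using coeffs_in_closure(1)[OF assms(2)] by (intro exI[of _ "cconst c"]) simp
next
  case (var v)
  then show ?case using assms(3) by (intro exI[of _ "Q v"]) simp
next
  case (add p q)
  then show ?case using coeffs_in_closure(3)[OF assms(2)] by (metis peval_add)
next
  case (mult p q)
  then show ?case using coeffs_in_closure(4)[OF assms(2)] by (metis peval_mult)
qed

text \<open>
Composition of polynomials. Only the induced function matters below, so any polynomial inducing it
will do.
\<close>
definition psubst :: "('v \<Rightarrow> 'u cpoly) \<Rightarrow> 'v cpoly \<Rightarrow> 'u cpoly" where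
  "psubst Q p = (SOME r. \<forall>z. peval r z = peval p (\<lambda>v. peval (Q v) z))"

lemma peval_psubst [simp]: "peval (psubst Q p) z = peval p (\<lambda>v. peval (Q v) z)"
proof -
  have "\<exists>r. \<forall>z. peval r z = peval p (\<lambda>v. peval (Q v) z)"
    using subst_exists[OF _ unital_subring_UNIV, of p Q] by (auto simp: coeffs_in_def)
  from someI_ex[OF this] show ?thesis by (simp add: psubst_def)
qed

section \<open>Directional derivatives of polynomials\<close>

text \<open>
Defining the directional derivative through the polynomial function, instead of formally on
coefficients, makes it depend on that function only and reduces the chain rule to the one of calculus.
\<close>
definition pdiff :: "'v cpoly \<Rightarrow> ('v \<Rightarrow> complex) \<Rightarrow> ('v \<Rightarrow> complex) \<Rightarrow> complex" where
  "pdiff p z w = deriv (\<lambda>t. peval p (\<lambda>v. z v + t * w v)) 0"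

text \<open>
The induction produces a derivative that depends on the velocity \<open>w\<close> and the position only; applying
this to the straight line through the same position identifies it as \<open>pdiff\<close>.
\<close>
lemma has_field_derivative_peval_curve:
  assumes "\<And>v. ((\<lambda>t. c t v) has_field_derivative w v) (at t)"
  shows "((\<lambda>t. peval p (c t)) has_field_derivative pdiff p (c t) w) (at t)"
proof -
  have ex: "\<exists>d. \<forall>c t. (\<forall>v. ((\<lambda>t. c t v) has_field_derivative w v) (at t)) \<longrightarrow> c t = z \<longrightarrow>
      ((\<lambda>t. peval p (c t)) has_field_derivative d) (at t)" for z
  proof (induction p rule: cpoly_generated_induct_UNIV)
    case (const c)
    then show ?case by (intro exI[of _ 0]) auto
  next
    case (var v)
    then show ?case unfolding peval_cvar by blast
  next
    case (add p q)
    then obtain d e where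
      d: "\<And>c t. (\<forall>v. ((\<lambda>t. c t v) has_field_derivative w v) (at t)) \<Longrightarrow> c t = z \<Longrightarrow>
        ((\<lambda>t. peval p (c t)) has_field_derivative d) (at t)" and
      e: "\<And>c t. (\<forall>v. ((\<lambda>t. c t v) has_field_derivative w v) (at t)) \<Longrightarrow> c t = z \<Longrightarrow>
        ((\<lambda>t. peval q (c t)) has_field_derivative e) (at t)"
      by auto
    show ?case
      unfolding peval_add using DERIV_add[OF d e] by blast
  next
    case (mult p q)
    then obtain d e where
      d: "\<And>c t. (\<forall>v. ((\<lambda>t. c t v) has_field_derivative w v) (at t)) \<Longrightarrow> c t = z \<Longrightarrow>
        ((\<lambda>t. peval p (c t)) has_field_derivative d) (at t)" and
      e: "\<And>c t. (\<forall>v. ((\<lambda>t. c t v) has_field_derivative w v) (at t)) \<Longrightarrow> c t = z \<Longrightarrow>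
        ((\<lambda>t. peval q (c t)) has_field_derivative e) (at t)"
      by auto
    have "((\<lambda>t. peval p (c t) * peval q (c t)) has_field_derivative d * peval q z + e * peval p z) (at t)"
      if "\<forall>v. ((\<lambda>t. c t v) has_field_derivative w v) (at t)" "c t = z" for c t
      using DERIV_mult[OF d[OF that] e[OF that]] that(2) by simp
    then show ?case
      unfolding peval_mult by blast
  qed
  obtain d where d: "\<And>c' t'. (\<forall>v. ((\<lambda>t. c' t v) has_field_derivative w v) (at t')) \<Longrightarrow> c' t' = c t \<Longrightarrow>
      ((\<lambda>t. peval p (c' t)) has_field_derivative d) (at t')"
    using ex[of "c t"] by blast
  have "((\<lambda>s. peval p (\<lambda>v. c t v + s * w v)) has_field_derivative d) (at 0)"
    by (rule d) (auto intro!: derivative_eq_intros)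
  then have "pdiff p (c t) w = d"
    unfolding pdiff_def by (rule DERIV_imp_deriv)
  then show ?thesis
    using d[of c t] assms by simp
qed

lemma pdiff_eqI:
  assumes "((\<lambda>t. peval p (\<lambda>v. z v + t * w v)) has_field_derivative d) (at 0)"
  shows "pdiff p z w = d"
  using assms unfolding pdiff_def by (rule DERIV_imp_deriv)

lemma has_field_derivative_peval_line:
  "((\<lambda>t. peval p (\<lambda>v. z v + t * w v)) has_field_derivative pdiff p z w) (at 0)"
proof -
  have "((\<lambda>t. z v + t * w v) has_field_derivative w v) (at 0)" for v
    by (auto intro!: derivative_eq_intros)
  then show ?thesis
    using has_field_derivative_peval_curve[of "\<lambda>t v. z v + t * w v" w 0 p] by simp
qed

lemma pdiff_cong: "(\<And>z. peval p z = peval q z) \<Longrightarrow> pdiff p z w = pdiff q z w"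
  by (simp add: pdiff_def)

lemma pdiff_cconst [simp]: "pdiff (cconst c) z w = 0"
  by (rule pdiff_eqI) simp

lemma pdiff_cvar [simp]: "pdiff (cvar v) z w = w v"
  by (rule pdiff_eqI) (auto intro!: derivative_eq_intros)

lemma pdiff_add: "pdiff (p + q) z w = pdiff p z w + pdiff q z w"
  by (rule pdiff_eqI)
    (auto simp: peval_add intro!: derivative_eq_intros has_field_derivative_peval_line)

lemma pdiff_mult: "pdiff (p * q) z w = pdiff p z w * peval q z + peval p z * pdiff q z w"
  by (rule pdiff_eqI)
    (auto simp: peval_mult intro!: derivative_eq_intros has_field_derivative_peval_line)

lemma pdiff_zero [simp]: "pdiff 0 z w = 0"
  using pdiff_cconst[of 0] by simp

lemma pdiff_sum: "pdiff (sum f A) z w = (\<Sum>i\<in>A. pdiff (f i) z w)"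
  by (induction A rule: infinite_finite_induct) (simp_all add: pdiff_add)

lemma pdiff_linear: "pdiff p z (\<lambda>v. a * w v + b * w' v) = a * pdiff p z w + b * pdiff p z w'"
  by (induction p rule: cpoly_generated_induct_UNIV)
    (simp_all add: pdiff_add pdiff_mult algebra_simps)

lemma pdiff_zero_right [simp]: "pdiff p z (\<lambda>v. 0) = 0"
  using pdiff_linear[of p z 0 "\<lambda>v. 0" 0 "\<lambda>v. 0"] by simp

lemma pdiff_sum_right: "pdiff p z (\<lambda>v. \<Sum>i\<in>A. a i * w i v) = (\<Sum>i\<in>A. a i * pdiff p z (w i))"
proof (induction A rule: infinite_finite_induct)
  case (insert i A)
  then show ?case
    using pdiff_linear[of p z "a i" "w i" 1 "\<lambda>v. \<Sum>i\<in>A. a i * w i v"] by simp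
qed simp_all

lemma pdiff_subst:
  assumes "\<And>z. peval r z = peval p (\<lambda>v. peval (Q v) z)"
  shows "pdiff r z w = pdiff p (\<lambda>v. peval (Q v) z) (\<lambda>v. pdiff (Q v) z w)"
proof (rule pdiff_eqI)
  show "((\<lambda>t. peval r (\<lambda>v. z v + t * w v)) has_field_derivative
      pdiff p (\<lambda>v. peval (Q v) z) (\<lambda>v. pdiff (Q v) z w)) (at 0)"
    unfolding assms
    using has_field_derivative_peval_curve[of "\<lambda>t v. peval (Q v) (\<lambda>v. z v + t * w v)"
        "\<lambda>v. pdiff (Q v) z w" 0 p]
    by (simp add: has_field_derivative_peval_line)
qed

lemma pdiff_psubst [simp]:
  "pdiff (psubst Q p) z w = pdiff p (\<lambda>v. peval (Q v) z) (\<lambda>v. pdiff (Q v) z w)"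
  by (rule pdiff_subst) simp

lemma peval_uminus: "peval (- p) z = - peval p z"
  using peval_add[of p "- p" z] by (simp add: eq_neg_iff_add_eq_0 add.commute)

lemma peval_diff: "peval (p - q) z = peval p z - peval q z"
  using peval_add[of p "- q" z] by (simp add: peval_uminus)

lemma pdiff_uminus: "pdiff (- p) z w = - pdiff p z w"
  using pdiff_add[of p "- p" z w] by (simp add: eq_neg_iff_add_eq_0 add.commute)

lemma pdiff_diff: "pdiff (p - q) z w = pdiff p z w - pdiff q z w"
  using pdiff_add[of p "- q" z w] by (simp add: pdiff_uminus)

lemma peval_of_int [simp]: "peval (of_int n) z = of_int n"
  using peval_single[of 0 "of_int n" z] by simp

lemma peval_sum: "peval (sum f A) z = (\<Sum>i\<in>A. peval (f i) z)"
  by (induction A rule: infinite_finite_induct) (simp_all add: peval_add)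

lemma peval_prod: "peval (prod f A) z = (\<Prod>i\<in>A. peval (f i) z)"
  by (induction A rule: infinite_finite_induct) (simp_all add: peval_mult)

text \<open>
A polynomial vector field \<open>W\<close> acts on polynomials as a derivation.
\<close>
lemma pdiff_field_poly_exists:
  "\<exists>r. \<forall>z. peval r z = pdiff p z (\<lambda>v. peval (W v) z)"
proof (induction p rule: cpoly_generated_induct_UNIV)
  case (const c)
  show ?case by (intro exI[of _ 0]) simp
next
  case (var v)
  show ?case by (intro exI[of _ "W v"]) simp
next
  case (add p q)
  then show ?case by (metis peval_add pdiff_add)
next
  case (mult p q)
  then obtain r s where "\<forall>z. peval r z = pdiff p z (\<lambda>v. peval (W v) z)"
    "\<forall>z. peval s z = pdiff q z (\<lambda>v. peval (W v) z)" by blast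
  then show ?case
    by (intro exI[of _ "r * q + p * s"]) (simp add: peval_add peval_mult pdiff_mult)
qed

lemma has_derivative_peval:
  fixes c :: "'a::real_normed_vector \<Rightarrow> 'v \<Rightarrow> complex"
  assumes "\<And>v. ((\<lambda>t. c t v) has_derivative c' v) (at t)"
  shows "((\<lambda>t. peval p (c t)) has_derivative (\<lambda>h. pdiff p (c t) (\<lambda>v. c' v h))) (at t)"
proof (induction p rule: cpoly_generated_induct_UNIV)
  case (const c)
  then show ?case by simp
next
  case (var v)
  then show ?case using assms by simp
next
  case (add p q)
  then show ?case unfolding peval_add pdiff_add by (rule has_derivative_add)
next
  case (mult p q)
  then have "((\<lambda>t. peval p (c t) * peval q (c t)) has_derivative
      (\<lambda>h. peval p (c t) * pdiff q (c t) (\<lambda>v. c' v h) + pdiff p (c t) (\<lambda>v. c' v h) * peval q (c t))) (at t)"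
    by (rule has_derivative_mult)
  then show ?case by (simp add: peval_mult pdiff_mult add.commute)
qed

lemma continuous_on_peval:
  assumes "\<And>v. continuous_on S (\<lambda>t. c t v)"
  shows "continuous_on S (\<lambda>t. peval p (c t))"
  by (induction p rule: cpoly_generated_induct_UNIV)
    (auto simp: peval_add peval_mult assms intro!: continuous_intros)

lemma has_derivative_vec_lambda:
  fixes f :: "'a::real_normed_vector \<Rightarrow> 'i::finite \<Rightarrow> 'b::real_normed_vector"
  assumes "\<And>i. ((\<lambda>x. f x i) has_derivative f' i) (at x)"
  shows "((\<lambda>x. \<chi> i. f x i) has_derivative (\<lambda>h. \<chi> i. f' i h)) (at x)"
proof -
  have axis: "bounded_linear (axis i :: 'b \<Rightarrow> 'b^'i)" for i
  proof (rule bounded_linear_intro[of _ 1])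
    fix x :: 'b
    have "(norm (axis i x $ j))\<^sup>2 = (if j = i then (norm x)\<^sup>2 else 0)" for j
      by (simp add: axis_def)
    then have "(\<Sum>j\<in>UNIV. (norm (axis i x $ j))\<^sup>2) = (norm x)\<^sup>2"
      by (simp only: sum.delta finite UNIV_I if_True)
    then show "norm (axis i x :: 'b^'i) \<le> norm x * 1"
      by (simp add: norm_vec_def L2_set_def)
  qed (simp_all add: axis_def vec_eq_iff)
  have eq: "(\<chi> i. g i) = (\<Sum>i\<in>UNIV. axis i (g i))" for g :: "'i \<Rightarrow> 'b"
    by (simp add: vec_eq_iff axis_def)
  show ?thesis
    unfolding eq
    by (intro has_derivative_sum bounded_linear.has_derivative[OF axis] assms)
qed

section \<open>Complex conjugation of polynomials\<close>

lemma conjugate_poly_exists: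
  fixes p :: "'v cpoly"
  shows "\<exists>q. (\<forall>z. peval q z = cnj (peval p (\<lambda>v. cnj (z v)))) \<and>
    (\<forall>z w. pdiff q z w = cnj (pdiff p (\<lambda>v. cnj (z v)) (\<lambda>v. cnj (w v))))"
proof (induction p rule: cpoly_generated_induct_UNIV)
  case (const c)
  show ?case by (intro exI[of _ "cconst (cnj c)"]) simp
next
  case (var v)
  show ?case by (intro exI[of _ "cvar v"]) simp
next
  case (add p q)
  then obtain p' q' where "\<forall>z. peval p' z = cnj (peval p (\<lambda>v. cnj (z v)))"
    "\<forall>z w. pdiff p' z w = cnj (pdiff p (\<lambda>v. cnj (z v)) (\<lambda>v. cnj (w v)))"
    "\<forall>z. peval q' z = cnj (peval q (\<lambda>v. cnj (z v)))"
    "\<forall>z w. pdiff q' z w = cnj (pdiff q (\<lambda>v. cnj (z v)) (\<lambda>v. cnj (w v)))" by blast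
  then show ?case by (intro exI[of _ "p' + q'"]) (simp add: peval_add pdiff_add)
next
  case (mult p q)
  then obtain p' q' where "\<forall>z. peval p' z = cnj (peval p (\<lambda>v. cnj (z v)))"
    "\<forall>z w. pdiff p' z w = cnj (pdiff p (\<lambda>v. cnj (z v)) (\<lambda>v. cnj (w v)))"
    "\<forall>z. peval q' z = cnj (peval q (\<lambda>v. cnj (z v)))"
    "\<forall>z w. pdiff q' z w = cnj (pdiff q (\<lambda>v. cnj (z v)) (\<lambda>v. cnj (w v)))" by blast
  then show ?case by (intro exI[of _ "p' * q'"]) (simp add: peval_mult pdiff_mult)
qed

text \<open>
The polynomial with conjugate coefficients, characterised by its values and derivatives.
\<close>
definition pcnj :: "'v cpoly \<Rightarrow> 'v cpoly" where
  "pcnj p = (SOME q. (\<forall>z. peval q z = cnj (peval p (\<lambda>v. cnj (z v)))) \<and>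
    (\<forall>z w. pdiff q z w = cnj (pdiff p (\<lambda>v. cnj (z v)) (\<lambda>v. cnj (w v)))))"

lemma
  shows peval_pcnj: "peval (pcnj p) z = cnj (peval p (\<lambda>v. cnj (z v)))"
    and pdiff_pcnj: "pdiff (pcnj p) z w = cnj (pdiff p (\<lambda>v. cnj (z v)) (\<lambda>v. cnj (w v)))"
  using someI_ex[OF conjugate_poly_exists[of p]] unfolding pcnj_def by blast+

definition real_function :: "'v cpoly \<Rightarrow> bool" where
  "real_function p \<longleftrightarrow> (\<forall>z. peval p (\<lambda>v. cnj (z v)) = cnj (peval p z))"

lemma real_function_real_cpoly: "real_cpoly p \<Longrightarrow> real_function p"
  unfolding real_function_def peval_def monom_eval_def real_cpoly_def
  by (auto simp: cnj_sum cnj_prod Reals_cnj_iff intro!: sum.cong)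

lemma real_function_pdiff:
  assumes "real_function p"
  shows "pdiff p (\<lambda>v. cnj (z v)) (\<lambda>v. cnj (w v)) = cnj (pdiff p z w)"
proof -
  have "pdiff p z w = pdiff (pcnj p) z w"
    by (rule pdiff_cong) (use assms in \<open>simp add: peval_pcnj real_function_def\<close>)
  then show ?thesis by (simp add: pdiff_pcnj)
qed

section \<open>Extending derivations\<close>

text \<open>
The ring \<open>S\<close> is a carrier set inside a larger ring in which \<open>D\<close> takes its values; \<open>D\<close> is arbitrary
outside \<open>S\<close>.
\<close>
definition derivation_on :: "'a::comm_ring_1 set \<Rightarrow> ('a \<Rightarrow> 'a) \<Rightarrow> bool" where
  "derivation_on S D \<longleftrightarrow> unital_subring S \<and>
     (\<forall>a\<in>S. \<forall>b\<in>S. D (a + b) = D a + D b \<and> D (a * b) = D a * b + a * D b)"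

lemma derivation_on_zero: "derivation_on S D \<Longrightarrow> D 0 = 0"
  unfolding derivation_on_def by (metis add.right_neutral add_cancel_right_right unital_subringD(1))

lemma derivation_on_sum:
  assumes "derivation_on S D" "\<And>i. i \<in> A \<Longrightarrow> f i \<in> S"
  shows "D (sum f A) = (\<Sum>i\<in>A. D (f i))"
  using assms(2)
proof (induction A rule: infinite_finite_induct)
  case (insert i A)
  then show ?case
    using assms(1) unital_subring_sum[of S A f] by (simp add: derivation_on_def)
qed (simp_all add: derivation_on_zero[OF assms(1)])

text \<open>
Elements of \<open>S[u]\<close> are values \<open>q(u)\<close>, and a derivation sending \<open>u\<close> to \<open>e\<close> must map \<open>q(u)\<close> to
\<open>\<Delta> e q = q\<^sup>D(u) + q'(u) e\<close>. This is well defined if \<open>\<Delta> e\<close> kills all relations \<open>q(u) = 0\<close>. If there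
are nontrivial ones, let \<open>P\<close> be one of least degree; then \<open>P'(u) \<noteq> 0\<close> in characteristic zero and the
condition \<open>\<Delta> e P = 0\<close> determines \<open>e\<close>. Pseudo-division by \<open>P\<close> reduces every other relation to \<open>P\<close>.
\<close>
lemma derivation_on_adjoin:
  fixes S :: "'a::field_char_0 set"
  assumes D: "derivation_on S D"
  shows "\<exists>S' D'. derivation_on S' D' \<and> S \<subseteq> S' \<and> u \<in> S' \<and> (\<forall>a\<in>S. D' a = D a)"
proof -
  have S: "unital_subring S" and
    D_add: "\<And>a b. a \<in> S \<Longrightarrow> b \<in> S \<Longrightarrow> D (a + b) = D a + D b" and
    D_mult: "\<And>a b. a \<in> S \<Longrightarrow> b \<in> S \<Longrightarrow> D (a * b) = D a * b + a * D b"
    using D by (auto simp: derivation_on_def)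
  note SD = unital_subringD[OF S]
  have D0 [simp]: "D 0 = 0" by (rule derivation_on_zero[OF D])
  have D1 [simp]: "D 1 = 0" using D_mult[of 1 1] SD(2) by simp
  define R where "R = {q :: 'a poly. \<forall>i. coeff q i \<in> S}"
  have R_mult: "p * q \<in> R" if "p \<in> R" "q \<in> R" for p q
    using that by (auto simp: R_def coeff_mult intro!: unital_subring_sum[OF S] SD(5))
  have R_add: "p + q \<in> R" "p - q \<in> R" if "p \<in> R" "q \<in> R" for p q
    using that SD(3,4) by (auto simp: R_def)
  have R_monom: "monom a n \<in> R" if "a \<in> S" for a n
    using that SD(1) by (auto simp: R_def)
  have R_const: "[:a:] \<in> R" if "a \<in> S" for a
    using that SD(1) by (auto simp: R_def coeff_pCons split: nat.split)
  have R_X: "[:0, 1:] \<in> R"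
    using SD(1,2) by (auto simp: R_def coeff_pCons split: nat.split)
  have md_add: "map_poly D (p + q) = map_poly D p + map_poly D q" if "p \<in> R" "q \<in> R" for p q
    using that D_add by (intro poly_eqI) (auto simp: coeff_map_poly R_def)
  have md_mult: "map_poly D (p * q) = map_poly D p * q + p * map_poly D q"
    if "p \<in> R" "q \<in> R" for p q
  proof (rule poly_eqI)
    fix n
    have pq: "coeff p i \<in> S" "coeff q i \<in> S" for i
      using that by (auto simp: R_def)
    have "coeff (map_poly D (p * q)) n = D (\<Sum>i\<le>n. coeff p i * coeff q (n - i))"
      by (simp add: coeff_map_poly coeff_mult)
    also have "\<dots> = (\<Sum>i\<le>n. D (coeff p i * coeff q (n - i)))"
      by (rule derivation_on_sum[OF D]) (use pq SD(5) in blast)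
    also have "\<dots> = coeff (map_poly D p * q + p * map_poly D q) n"
      using pq by (simp add: D_mult coeff_mult coeff_map_poly sum.distrib)
    finally show "coeff (map_poly D (p * q)) n = coeff (map_poly D p * q + p * map_poly D q) n" .
  qed
  define \<Delta> where "\<Delta> e q = poly (map_poly D q) u + poly (pderiv q) u * e" for e q
  have \<Delta>_add: "\<Delta> e (p + q) = \<Delta> e p + \<Delta> e q" if "p \<in> R" "q \<in> R" for e p q
    using that by (simp add: \<Delta>_def md_add pderiv_add algebra_simps)
  have \<Delta>_mult: "\<Delta> e (p * q) = \<Delta> e p * poly q u + poly p u * \<Delta> e q" if "p \<in> R" "q \<in> R" for e p q
    using that by (simp add: \<Delta>_def md_mult pderiv_mult algebra_simps)
  have \<Delta>_const: "\<Delta> e [:a:] = D a" for e a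
    by (simp add: \<Delta>_def map_poly_pCons pderiv_pCons)
  have \<Delta>_0: "\<Delta> e 0 = 0" for e by (simp add: \<Delta>_def)
  have "\<exists>e. \<forall>q\<in>R. poly q u = 0 \<longrightarrow> \<Delta> e q = 0"
  proof (cases "\<exists>q\<in>R. q \<noteq> 0 \<and> poly q u = 0")
    case False
    then show ?thesis using \<Delta>_0 by metis
  next
    case True
    define P where "P = (ARG_MIN degree q. q \<in> R \<and> q \<noteq> 0 \<and> poly q u = 0)"
    have P: "P \<in> R" "P \<noteq> 0" "poly P u = 0" and
      P_min: "\<And>q. q \<in> R \<Longrightarrow> q \<noteq> 0 \<Longrightarrow> poly q u = 0 \<Longrightarrow> degree P \<le> degree q"
      using arg_min_natI[of "\<lambda>q. q \<in> R \<and> q \<noteq> 0 \<and> poly q u = 0" _ degree]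
        arg_min_nat_le[of "\<lambda>q. q \<in> R \<and> q \<noteq> 0 \<and> poly q u = 0" _ degree] True
      unfolding P_def by blast+
    have deg_P: "degree P \<noteq> 0"
    proof
      assume "degree P = 0"
      then obtain a where "P = [:a:]" by (meson degree_eq_zeroE)
      then show False using P by auto
    qed
    have "pderiv P \<in> R"
    proof -
      have "of_nat n * a \<in> S" if "a \<in> S" for n a
        using that by (induction n) (auto simp: algebra_simps intro: SD)
      then show ?thesis
        using P(1) by (auto simp: R_def coeff_pderiv simp del: of_nat_Suc)
    qed
    moreover have "degree (pderiv P) < degree P" "pderiv P \<noteq> 0"
      using deg_P by (auto simp: degree_pderiv pderiv_eq_0_iff)
    ultimately have P'u: "poly (pderiv P) u \<noteq> 0"
      using P_min[of "pderiv P"] by auto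
    define e where "e = - poly (map_poly D P) u / poly (pderiv P) u"
    have \<Delta>P: "\<Delta> e P = 0"
      using P'u by (simp add: \<Delta>_def e_def)
    have "\<Delta> e q = 0" if "q \<in> R" "poly q u = 0" for q
      using that
    proof (induction "degree q" arbitrary: q rule: less_induct)
      case (less q)
      show ?case
      proof (cases "q = 0 \<or> degree q = 0")
        case True
        then show ?thesis
        proof
          assume "degree q = 0"
          then obtain a where "q = [:a:]" by (meson degree_eq_zeroE)
          then show ?thesis using less.prems \<Delta>_0 by simp
        qed (simp add: \<Delta>_0)
      next
        case False
        define c where "c = lead_coeff P"
        define s where "s = monom (lead_coeff q) (degree q - degree P)"
        \<comment> \<open>One step of pseudo-division, which stays inside \<open>S\<close> because nothing is inverted.\<close>
        define r where "r = [:c:] * q - s * P"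
        have "degree P \<le> degree q" using P_min[of q] less.prems False by auto
        have mem: "[:c:] \<in> R" "s \<in> R" "c \<in> S"
          using P(1) less.prems(1) R_const R_monom by (auto simp: c_def s_def R_def)
        have rR: "r \<in> R"
          unfolding r_def by (intro R_add R_mult mem P less.prems)
        have "degree r < degree q"
        proof -
          have "degree ([:c:] * q) \<le> degree q" by (simp add: degree_smult_le)
          moreover have "degree (s * P) \<le> degree q"
            using degree_mult_le[of s P] degree_monom_le[of "lead_coeff q" "degree q - degree P"]
              \<open>degree P \<le> degree q\<close> unfolding s_def by linarith
          ultimately have "degree r \<le> degree q" unfolding r_def by (rule degree_diff_le)
          moreover have "coeff r (degree q) = 0"
            using \<open>degree P \<le> degree q\<close> by (simp add: r_def s_def c_def coeff_monom_mult)
          ultimately show ?thesis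
            using False
            by (metis degree_0 eq_zero_or_degree_less leD le_neq_implies_less leading_coeff_0_iff
                bot_nat_0.not_eq_extremum)
        qed
        moreover have "poly r u = 0"
          by (simp add: r_def P less.prems)
        ultimately have "\<Delta> e r = 0"
          using less.hyps rR by blast
        moreover have "[:c:] * q = r + s * P"
          by (simp add: r_def)
        then have "\<Delta> e ([:c:] * q) = \<Delta> e r + \<Delta> e (s * P)"
          using \<Delta>_add[OF rR R_mult[OF mem(2) P(1)]] by simp
        ultimately have "c * \<Delta> e q = 0"
          using \<Delta>_mult[OF mem(1) less.prems(1), of e] \<Delta>_mult[OF mem(2) P(1), of e] \<Delta>P P less.prems
          by simp
        then show ?thesis using P(2) by (simp add: c_def)
      qed
    qed
    then show ?thesis by blast
  qed
  then obtain e where e: "\<And>q. q \<in> R \<Longrightarrow> poly q u = 0 \<Longrightarrow> \<Delta> e q = 0" by blast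
  define S' where "S' = (\<lambda>q. poly q u) ` R"
  define D' where "D' s = \<Delta> e (SOME q. q \<in> R \<and> poly q u = s)" for s
  have D': "D' (poly q u) = \<Delta> e q" if "q \<in> R" for q
  proof -
    define q' where "q' = (SOME q'. q' \<in> R \<and> poly q' u = poly q u)"
    have q': "q' \<in> R" "poly q' u = poly q u"
      using someI[of "\<lambda>q'. q' \<in> R \<and> poly q' u = poly q u" q] that by (auto simp: q'_def)
    have "\<Delta> e ((q' - q) + q) = \<Delta> e (q' - q) + \<Delta> e q"
      using q' that by (intro \<Delta>_add R_add)
    moreover have "\<Delta> e (q' - q) = 0"
      using q' that by (intro e R_add) auto
    ultimately show ?thesis by (simp add: D'_def q'_def)
  qed
  have "derivation_on S' D'"
    unfolding derivation_on_def unital_subring_def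
  proof (intro conjI ballI)
    show "1 \<in> S'"
      unfolding S'_def by (rule image_eqI[of _ _ "[:1:]"]) (use R_const SD(2) in auto)
    fix a b assume "a \<in> S'" "b \<in> S'"
    then obtain p q where pq: "p \<in> R" "q \<in> R" "a = poly p u" "b = poly q u"
      by (auto simp: S'_def)
    show "a - b \<in> S'" "a * b \<in> S'"
      unfolding S'_def using pq R_add R_mult
      by (auto intro: image_eqI[of _ _ "p - q"] image_eqI[of _ _ "p * q"])
    show "D' (a + b) = D' a + D' b" "D' (a * b) = D' a * b + a * D' b"
      using D'[of "p + q"] D'[of "p * q"] pq R_add R_mult by (simp_all add: D' \<Delta>_add \<Delta>_mult)
  qed
  moreover have "u \<in> S'"
    unfolding S'_def by (rule image_eqI[OF _ R_X]) simp
  moreover have "a \<in> S'" "D' a = D a" if "a \<in> S" for a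
    using D'[OF R_const[OF that]] \<Delta>_const R_const[OF that]
    by (auto simp: S'_def intro!: image_eqI[of _ _ "[:a:]"])
  ultimately show ?thesis by blast
qed

lemma derivation_on_adjoin_finite:
  fixes S :: "'a::field_char_0 set"
  assumes "derivation_on S D" "finite U"
  shows "\<exists>S' D'. derivation_on S' D' \<and> S \<subseteq> S' \<and> U \<subseteq> S' \<and> (\<forall>a\<in>S. D' a = D a)"
  using assms(2)
proof induction
  case empty
  then show ?case using assms(1) by blast
next
  case (insert u U)
  then obtain S' D' where "derivation_on S' D'" "S \<subseteq> S'" "U \<subseteq> S'" "\<forall>a\<in>S. D' a = D a"
    by blast
  moreover obtain S'' D'' where "derivation_on S'' D''" "S' \<subseteq> S''" "u \<in> S''" "\<forall>a\<in>S'. D'' a = D' a"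
    using derivation_on_adjoin[OF \<open>derivation_on S' D'\<close>] by blast
  ultimately show ?case
    by (intro exI[of _ S''] exI[of _ D'']) auto
qed

lemma derivation_on_peval:
  assumes D: "derivation_on S D" and K: "unital_subring K" "K \<subseteq> S" "\<And>c. c \<in> K \<Longrightarrow> D c = 0"
    and z: "\<And>v. z v \<in> S" and p: "coeffs_in K p"
  shows "D (peval p z) = pdiff p z (\<lambda>v. D (z v))"
proof -
  have S: "unital_subring S" using D by (simp add: derivation_on_def)
  have "peval p z \<in> S \<and> D (peval p z) = pdiff p z (\<lambda>v. D (z v))"
    using p K(1)
  proof (induction p rule: cpoly_generated_induct)
    case (const c)
    then show ?case using K by auto
  next
    case (var v)
    then show ?case using z by simp
  next
    case (add p q)
    then show ?case
      using D unital_subringD(3)[OF S] by (simp add: derivation_on_def peval_add pdiff_add)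
  next
    case (mult p q)
    then show ?case
      using D unital_subringD(5)[OF S] by (simp add: derivation_on_def peval_mult pdiff_mult)
  qed
  then show ?thesis ..
qed

text \<open>
A vector \<open>w\<close> that is tangent at \<open>y\<close> to all polynomial relations over \<open>K\<close> satisfied by \<open>y\<close> is the
same as a \<open>K\<close>-derivation on \<open>K[y]\<close>: differences of two representations of the same element of \<open>K[y]\<close>
are such relations.
\<close>
lemma derivation_on_evaluation_ring:
  fixes y w :: "'v \<Rightarrow> complex"
  assumes K: "unital_subring K"
    and w: "\<And>p. coeffs_in K p \<Longrightarrow> peval p y = 0 \<Longrightarrow> pdiff p y w = 0"
  shows "\<exists>S D. derivation_on S D \<and> K \<subseteq> S \<and> (\<forall>c\<in>K. D c = 0) \<and> (\<forall>v. y v \<in> S \<and> D (y v) = w v)"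
proof -
  note C = coeffs_in_closure[OF K] and KD = unital_subringD[OF K]
  define S where "S = {peval p y | p. coeffs_in K p}"
  define D where "D s = pdiff (SOME p. coeffs_in K p \<and> peval p y = s) y w" for s
  have D: "D (peval p y) = pdiff p y w" if p: "coeffs_in K p" for p
  proof -
    define q where "q = (SOME q. coeffs_in K q \<and> peval q y = peval p y)"
    have q: "coeffs_in K q" "peval q y = peval p y"
      using someI[of "\<lambda>q. coeffs_in K q \<and> peval q y = peval p y" p] p by (auto simp: q_def)
    have "pdiff (q + cconst (-1) * p) y w = 0"
      using q p KD(2,6) by (intro w C) (auto simp: peval_add peval_mult)
    then show ?thesis by (simp add: D_def q_def pdiff_add pdiff_mult)
  qed
  have "derivation_on S D"
    unfolding derivation_on_def unital_subring_def
  proof (intro conjI ballI)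
    show "1 \<in> S"
      using C(1)[OF KD(2)] by (force simp: S_def)
    fix a b assume "a \<in> S" "b \<in> S"
    then obtain p q where pq: "coeffs_in K p" "coeffs_in K q" "a = peval p y" "b = peval q y"
      by (auto simp: S_def)
    have "coeffs_in K (p + cconst (-1) * q)"
      using pq KD(2,6) by (intro C) auto
    moreover have "a - b = peval (p + cconst (-1) * q) y"
      using pq by (simp add: peval_add peval_mult)
    ultimately show "a - b \<in> S" unfolding S_def by blast
    show "a * b \<in> S"
      using pq C(4) by (auto simp: S_def simp flip: peval_mult)
    show "D (a + b) = D a + D b" "D (a * b) = D a * b + a * D b"
      using D[OF C(3)[OF pq(1,2)]] D[OF C(4)[OF pq(1,2)]] pq
      by (simp_all add: D peval_add peval_mult pdiff_add pdiff_mult)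
  qed
  moreover have "c \<in> S \<and> D c = 0" if "c \<in> K" for c
    using D[OF C(1)[OF that]] C(1)[OF that] by (force simp: S_def)
  moreover have "y v \<in> S \<and> D (y v) = w v" for v
    using D[OF C(2)] C(2) by (force simp: S_def)
  ultimately show ?thesis by blast
qed

text \<open>
Tangent vectors lift through any polynomial map \<open>F\<close> over \<open>K\<close>, where tangency at a point is understood
with respect to the relations over \<open>K\<close> that hold at this point. The lift consists of the values that an
extension to \<open>K[F(\<xi>), \<xi>]\<close> of the derivation given by \<open>w\<close> takes on the coordinates of \<open>\<xi>\<close>.
\<close>
lemma tangent_lift:
  fixes F :: "'d \<Rightarrow> 'v::finite cpoly" and \<xi> :: "'v \<Rightarrow> complex" and w :: "'d \<Rightarrow> complex"
  assumes K: "unital_subring K" and F: "\<And>j. coeffs_in K (F j)"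
    and w: "\<And>p. coeffs_in K p \<Longrightarrow> peval p (\<lambda>j. peval (F j) \<xi>) = 0 \<Longrightarrow>
      pdiff p (\<lambda>j. peval (F j) \<xi>) w = 0"
  shows "\<exists>a. (\<forall>p. coeffs_in K p \<longrightarrow> peval p \<xi> = 0 \<longrightarrow> pdiff p \<xi> a = 0) \<and> (\<forall>j. pdiff (F j) \<xi> a = w j)"
proof -
  define y where "y = (\<lambda>j. peval (F j) \<xi>)"
  obtain S0 D0 where 0: "derivation_on S0 D0" "K \<subseteq> S0" "\<forall>c\<in>K. D0 c = 0"
      "\<forall>j. y j \<in> S0 \<and> D0 (y j) = w j"
    using derivation_on_evaluation_ring[OF K, of y w] w unfolding y_def by blast
  obtain S D where D: "derivation_on S D" "S0 \<subseteq> S" "range \<xi> \<subseteq> S" "\<forall>a\<in>S0. D a = D0 a"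
    using derivation_on_adjoin_finite[OF 0(1), of "range \<xi>"] by auto
  have eq: "D (peval p \<xi>) = pdiff p \<xi> (\<lambda>v. D (\<xi> v))" if "coeffs_in K p" for p
    by (rule derivation_on_peval[OF D(1) K _ _ _ that]) (use D 0 in auto)
  have "pdiff (F j) \<xi> (\<lambda>v. D (\<xi> v)) = w j" for j
    using eq[OF F, of j] 0(4) D(4) unfolding y_def by metis
  moreover have "pdiff p \<xi> (\<lambda>v. D (\<xi> v)) = 0" if "coeffs_in K p" "peval p \<xi> = 0" for p
    using eq[OF that(1)] that(2) derivation_on_zero[OF D(1)] by simp
  ultimately show ?thesis by blast
qed

section \<open>Generic points\<close>

interpretation cpoly_ideal: module "(*) :: 'v cpoly \<Rightarrow> 'v cpoly \<Rightarrow> 'v cpoly"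
  by (rule module_cpoly)

interpretation cpoly_vs: vector_space "\<lambda>c (p :: 'v cpoly). cconst c * p"
  by unfold_locales
    (simp_all add: distrib_left distrib_right single_add mult_single flip: mult.assoc)

text \<open>
As rewrite rules these reassociate products to the left, against the normal form used elsewhere.
\<close>
declare cpoly_ideal.scale_scale [simp del] cpoly_vs.scale_scale [simp del]

lemma countable_poly_mapping:
  assumes "countable (UNIV :: 'a set)" "countable K"
  shows "countable {p :: 'a \<Rightarrow>\<^sub>0 'b::zero. range (Poly_Mapping.lookup p) \<subseteq> K}"
proof -
  let ?P = "{p :: 'a \<Rightarrow>\<^sub>0 'b. range (Poly_Mapping.lookup p) \<subseteq> K}"
  let ?g = "\<lambda>p :: 'a \<Rightarrow>\<^sub>0 'b. (\<lambda>m. (m, Poly_Mapping.lookup p m)) ` Poly_Mapping.keys p"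
  have "inj_on ?g ?P"
  proof (rule inj_onI)
    fix p q :: "'a \<Rightarrow>\<^sub>0 'b"
    assume eq: "?g p = ?g q"
    show "p = q"
    proof (rule poly_mapping_eqI)
      fix m
      have "(m, c) \<in> ?g p \<longleftrightarrow> c = Poly_Mapping.lookup p m \<and> c \<noteq> 0" for p :: "'a \<Rightarrow>\<^sub>0 'b" and c
        by (auto simp: in_keys_iff)
      then show "Poly_Mapping.lookup p m = Poly_Mapping.lookup q m"
        using eq by (metis (no_types, lifting))
    qed
  qed
  moreover have "countable (?g ` ?P)"
  proof (rule countable_subset)
    show "?g ` ?P \<subseteq> {A. finite A \<and> A \<subseteq> UNIV \<times> K}" by auto
    show "countable {A. finite A \<and> A \<subseteq> (UNIV :: 'a set) \<times> K}"
      by (rule countable_Collect_finite_subset) (use assms in auto)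
  qed
  ultimately show ?thesis
    by (rule countable_image_inj_on[rotated])
qed

text \<open>
The monomials form a countable spanning set. An independent set meets the span of finitely many of
them in a finite set, and finitely many at a time they exhaust everything.
\<close>
lemma countable_independent_cpoly:
  fixes B :: "'v cpoly set"
  assumes "countable (UNIV :: 'v set)" "cpoly_vs.independent B"
  shows "countable B"
proof -
  have "countable (UNIV :: ('v \<Rightarrow>\<^sub>0 nat) set)"
    using countable_poly_mapping[OF assms(1), of "UNIV :: nat set"] by simp
  then obtain e :: "nat \<Rightarrow> 'v \<Rightarrow>\<^sub>0 nat" where e: "range e = UNIV"
    by (metis range_from_nat_into UNIV_not_empty)
  \<comment> \<open>The first \<open>n\<close> monomials in some enumeration.\<close>
  define T :: "nat \<Rightarrow> 'v cpoly set" where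
    "T n = (\<lambda>i. Poly_Mapping.single (e i) 1) ` {..<n}" for n
  have T_mono: "T m \<subseteq> T n" if "m \<le> n" for m n
    using that by (auto simp: T_def)
  have "\<exists>n. p \<in> cpoly_vs.span (T n)" for p
  proof (induction p rule: cpoly_induct)
    case zero
    show ?case by (intro exI[of _ 0] cpoly_vs.span_zero)
  next
    case (add p m c)
    then obtain n where n: "p \<in> cpoly_vs.span (T n)" ..
    obtain i where i: "m = e i" using e by (metis surjD)
    have "cconst c * Poly_Mapping.single m 1 \<in> cpoly_vs.span (T (Suc i))"
      by (intro cpoly_vs.span_scale cpoly_vs.span_base) (auto simp: T_def i)
    then have "Poly_Mapping.single m c \<in> cpoly_vs.span (T (Suc i))"
      by (simp add: mult_single)
    then have "p + Poly_Mapping.single m c \<in> cpoly_vs.span (T (max n (Suc i)))"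
      using n cpoly_vs.span_mono[OF T_mono[of n "max n (Suc i)"]]
        cpoly_vs.span_mono[OF T_mono[of "Suc i" "max n (Suc i)"]]
      by (intro cpoly_vs.span_add) auto
    then show ?case ..
  qed
  then have "B = (\<Union>n. B \<inter> cpoly_vs.span (T n))" by auto
  moreover have "finite (B \<inter> cpoly_vs.span (T n))" for n
    using cpoly_vs.independent_span_bound[of "T n" "B \<inter> cpoly_vs.span (T n)"]
      cpoly_vs.independent_mono[OF assms(2)] by (auto simp: T_def)
  then have "countable (\<Union>n. B \<inter> cpoly_vs.span (T n))"
    by (intro countable_UN) (auto intro: countable_finite)
  ultimately show ?thesis by simp
qed

lemma countable_spanning_subset:
  fixes V :: "'v cpoly set"
  assumes "countable (UNIV :: 'v set)"
  shows "\<exists>B\<subseteq>V. countable B \<and> V \<subseteq> cpoly_vs.span B"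
proof -
  obtain B where "B \<subseteq> V" "cpoly_vs.independent B" "V \<subseteq> cpoly_vs.span B"
    by (rule cpoly_vs.maximal_independent_subset)
  then show ?thesis using countable_independent_cpoly[OF assms] by blast
qed

lemma countable_subring_hull:
  assumes "countable (C :: 'a::comm_ring_1 set)"
  shows "\<exists>K. unital_subring K \<and> countable K \<and> C \<subseteq> K"
proof -
  define T where "T = rec_nat (insert 1 C)
    (\<lambda>_ A. A \<union> (\<lambda>(a, b). a - b) ` (A \<times> A) \<union> (\<lambda>(a, b). a * b) ` (A \<times> A))"
  have T_Suc: "T (Suc n) = T n \<union> (\<lambda>(a, b). a - b) ` (T n \<times> T n) \<union> (\<lambda>(a, b). a * b) ` (T n \<times> T n)"
    for n by (simp add: T_def)
  have T_0: "T 0 = insert 1 C" by (simp add: T_def)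
  have mono: "T m \<subseteq> T n" if "m \<le> n" for m n
    using that by (rule lift_Suc_mono_le[rotated]) (auto simp: T_Suc)
  have "countable (T n)" for n
    by (induction n) (use assms in \<open>auto simp: T_0 T_Suc\<close>)
  moreover have "unital_subring (\<Union>n. T n)"
    unfolding unital_subring_def
  proof (intro conjI ballI)
    show "1 \<in> (\<Union>n. T n)" using T_0 by blast
    fix a b assume "a \<in> (\<Union>n. T n)" "b \<in> (\<Union>n. T n)"
    then obtain m n where "a \<in> T m" "b \<in> T n" by blast
    then have "a \<in> T (max m n)" "b \<in> T (max m n)"
      using mono[of m "max m n"] mono[of n "max m n"] by auto
    then have "a - b \<in> T (Suc (max m n))" "a * b \<in> T (Suc (max m n))"
      by (force simp: T_Suc)+
    then show "a - b \<in> (\<Union>n. T n)" "a * b \<in> (\<Union>n. T n)" by blast+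
  qed
  moreover have "C \<subseteq> (\<Union>n. T n)" using T_0 by blast
  ultimately show ?thesis by (intro exI[of _ "\<Union>n. T n"]) auto
qed

text \<open>
Maximality says that adjoining any \<open>p \<notin> M\<close> to \<open>M\<close> produces an element of \<open>Q\<close>; this is how \<open>p\<close>
becomes invertible after inverting \<open>Q\<close> and dividing by \<open>M\<close>.
\<close>
lemma maximal_ideal_avoiding:
  fixes I Q :: "'v cpoly set"
  assumes I: "cpoly_ideal.subspace I" and disj: "I \<inter> Q = {}"
  shows "\<exists>M. cpoly_ideal.subspace M \<and> I \<subseteq> M \<and> M \<inter> Q = {} \<and>
    (\<forall>p. p \<notin> M \<longrightarrow> (\<exists>s\<in>Q. \<exists>r. s - r * p \<in> M))"
proof -
  define A where "A = {J. cpoly_ideal.subspace J \<and> I \<subseteq> J \<and> J \<inter> Q = {}}"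
  have "\<exists>M\<in>A. \<forall>X\<in>A. M \<subseteq> X \<longrightarrow> X = M"
  proof (rule subset_Zorn_nonempty)
    show "A \<noteq> {}" using I disj by (auto simp: A_def)
    fix C assume C: "C \<noteq> {}" "subset.chain A C"
    have C_ideal: "cpoly_ideal.subspace J" if "J \<in> C" for J
      using C(2) that by (auto simp: A_def subset_chain_def)
    have "cpoly_ideal.subspace (\<Union>C)"
    proof (rule cpoly_ideal.subspaceI)
      show "0 \<in> \<Union>C"
        using C(1) C_ideal cpoly_ideal.subspace_0 by blast
      show "r * p \<in> \<Union>C" if "p \<in> \<Union>C" for r p
      proof -
        obtain J where J: "J \<in> C" "p \<in> J" using \<open>p \<in> \<Union>C\<close> by blast
        then have "r * p \<in> J" using C_ideal cpoly_ideal.subspace_scale by blast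
        then show ?thesis using J by blast
      qed
      fix p q assume "p \<in> \<Union>C" "q \<in> \<Union>C"
      then obtain J J' where JJ: "J \<in> C" "J' \<in> C" "p \<in> J" "q \<in> J'" by blast
      then have "J \<subseteq> J' \<or> J' \<subseteq> J" using C(2) by (auto simp: subset_chain_def)
      then obtain L where L: "L \<in> C" "p \<in> L" "q \<in> L" using JJ by blast
      then have "p + q \<in> L" using C_ideal cpoly_ideal.subspace_add by blast
      then show "p + q \<in> \<Union>C" using L by blast
    qed
    then show "\<Union>C \<in> A"
      using C by (auto simp: A_def subset_chain_def)
  qed
  then obtain M where M: "M \<in> A" and max: "\<And>X. X \<in> A \<Longrightarrow> M \<subseteq> X \<Longrightarrow> X = M" by blast
  have ideal: "cpoly_ideal.subspace M" using M by (simp add: A_def)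
  have inv: "\<exists>s\<in>Q. \<exists>r. s - r * p \<in> M" if p: "p \<notin> M" for p
  proof -
    define X where "X = {q. \<exists>r. q - r * p \<in> M}"
    have "cpoly_ideal.subspace X"
    proof (rule cpoly_ideal.subspaceI)
      show "0 \<in> X"
        unfolding X_def using cpoly_ideal.subspace_0[OF ideal] by (auto intro: exI[of _ 0])
      fix a b assume "a \<in> X" "b \<in> X"
      then obtain r r' where "a - r * p \<in> M" "b - r' * p \<in> M" by (auto simp: X_def)
      then have "(a - r * p) + (b - r' * p) \<in> M" by (rule cpoly_ideal.subspace_add[OF ideal])
      then show "a + b \<in> X"
        unfolding X_def by (intro CollectI exI[of _ "r + r'"]) (simp add: algebra_simps)
    next
      fix c a assume "a \<in> X"
      then obtain r where "a - r * p \<in> M" by (auto simp: X_def)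
      then have "c * (a - r * p) \<in> M" by (rule cpoly_ideal.subspace_scale[OF ideal])
      then show "c * a \<in> X"
        unfolding X_def by (intro CollectI exI[of _ "c * r"]) (simp add: algebra_simps)
    qed
    moreover have MX: "M \<subseteq> X"
      unfolding X_def by (intro subsetI CollectI exI[of _ 0]) simp
    moreover have "p \<in> X"
      unfolding X_def using cpoly_ideal.subspace_0[OF ideal] by (intro CollectI exI[of _ 1]) simp
    then have "X \<noteq> M" using p by blast
    then have "X \<notin> A" using max MX by blast
    moreover have "I \<subseteq> X" using M MX by (auto simp: A_def)
    ultimately have "X \<inter> Q \<noteq> {}" by (simp add: A_def)
    then show ?thesis unfolding X_def by blast
  qed
  have "I \<subseteq> M" "M \<inter> Q = {}" using M by (simp_all add: A_def)
  with ideal inv show ?thesis by blast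
qed

text \<open>
An ideal in countably many variables that avoids a countable multiplicative set \<open>Q\<close> has a zero at which
no element of \<open>Q\<close> vanishes. An ideal \<open>M \<supseteq> I\<close> maximal among those avoiding \<open>Q\<close> is prime, and it
suffices that every variable \<open>u\<close> is congruent to a constant modulo \<open>M\<close>, since the constants are then
the coordinates of the zero. Otherwise \<open>u - c\<close> has for each \<open>c\<close> an inverse \<open>r c\<close> modulo \<open>M\<close> up to a
denominator in \<open>Q\<close>. Uncountably many \<open>c\<close> share the same denominator, while the polynomials have
countable dimension over \<open>\<complex>\<close>, so there is a linear relation between some of the \<open>r c\<close>. Clearing
denominators turns it into a nonzero polynomial in \<open>u\<close> that lies in \<open>M\<close>; it splits into linear factors
over \<open>\<complex>\<close>, and one of them lies in \<open>M\<close>.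
\<close>
lemma countable_nullstellensatz:
  fixes I Q :: "'v cpoly set"
  assumes v: "countable (UNIV :: 'v set)"
    and I: "cpoly_ideal.subspace I" and Q: "countable Q" "1 \<in> Q"
    and Q_mult: "\<And>s t. s \<in> Q \<Longrightarrow> t \<in> Q \<Longrightarrow> s * t \<in> Q"
    and disj: "I \<inter> Q = {}"
  shows "\<exists>z. (\<forall>p\<in>I. peval p z = 0) \<and> (\<forall>s\<in>Q. peval s z \<noteq> 0)"
proof -
  obtain M where ideal: "cpoly_ideal.subspace M" and "I \<subseteq> M" and MQ: "M \<inter> Q = {}"
    and inv: "\<And>p. p \<notin> M \<Longrightarrow> \<exists>s\<in>Q. \<exists>r. s - r * p \<in> M"
    using maximal_ideal_avoiding[OF I disj] by blast
  note M_add = cpoly_ideal.subspace_add[OF ideal] and M_mult = cpoly_ideal.subspace_scale[OF ideal]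
    and M_diff = cpoly_ideal.subspace_diff[OF ideal] and M_sum = cpoly_ideal.subspace_sum[OF ideal]
  have prime: "p \<in> M \<or> q \<in> M" if "p * q \<in> M" for p q
  proof (rule ccontr)
    assume "\<not> (p \<in> M \<or> q \<in> M)"
    then obtain s t r r' where st: "s \<in> Q" "t \<in> Q" "s - r * p \<in> M" "t - r' * q \<in> M"
      using inv by metis
    have "t * (s - r * p) + (r * p) * (t - r' * q) + (r * r') * (p * q) \<in> M"
      by (intro M_add M_mult st that)
    also have "t * (s - r * p) + (r * p) * (t - r' * q) + (r * r') * (p * q) = s * t"
      by (simp add: algebra_simps)
    finally have "s * t \<in> M" .
    then show False using Q_mult[OF st(1,2)] MQ by blast
  qed
  have const: "c = 0" if "cconst c \<in> M" for c
  proof (rule ccontr)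
    assume "c \<noteq> 0"
    have "cconst (1 / c) * cconst c \<in> M" by (rule M_mult[OF that])
    then have "1 \<in> M" using \<open>c \<noteq> 0\<close> by (simp add: mult_single)
    then show False using Q(2) MQ by blast
  qed
  have "\<exists>c. cvar v - cconst c \<in> M" for v
  proof (rule ccontr)
    assume not: "\<nexists>c. cvar v - cconst c \<in> M"
    define u where "u = (cvar v :: 'v cpoly)"
    have "\<forall>c. \<exists>s r. s \<in> Q \<and> s - r * (u - cconst c) \<in> M"
      using inv not unfolding u_def by blast
    then obtain s r where sr: "\<And>c. s c \<in> Q" "\<And>c. s c - r c * (u - cconst c) \<in> M"
      by metis
    define \<phi> where "\<phi> h = poly (map_poly (\<lambda>c. cconst c) h) u" for h
    have \<phi>_pCons: "\<phi> (pCons a h) = cconst a + u * \<phi> h" for a h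
      by (simp add: \<phi>_def map_poly_pCons)
    have \<phi>_0: "\<phi> 0 = 0" by (simp add: \<phi>_def)
    have \<phi>_add: "\<phi> (h + k) = \<phi> h + \<phi> k" for h k
    proof -
      have "map_poly (\<lambda>c. cconst c :: 'v cpoly) (h + k) = map_poly (\<lambda>c. cconst c) h + map_poly (\<lambda>c. cconst c) k"
        by (intro poly_eqI) (simp add: coeff_map_poly single_add)
      then show ?thesis by (simp add: \<phi>_def)
    qed
    have \<phi>_smult: "\<phi> (smult a h) = cconst a * \<phi> h" for a h
      by (induction h) (simp_all add: \<phi>_0 \<phi>_pCons mult_single algebra_simps)
    have \<phi>_mult: "\<phi> (h * k) = \<phi> h * \<phi> k" for h k
      by (induction h) (simp_all add: \<phi>_0 \<phi>_pCons \<phi>_add \<phi>_smult algebra_simps)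
    have \<phi>_1: "\<phi> 1 = 1"
      using \<phi>_pCons[of 1 0] by (simp add: \<phi>_0 one_pCons)
    have \<phi>_linear: "\<phi> [:- c, 1:] = u - cconst c" for c
      by (simp add: \<phi>_pCons \<phi>_0 single_uminus)
    have \<phi>_prod: "\<phi> (prod f A) = (\<Prod>i\<in>A. \<phi> (f i))" for f :: "complex \<Rightarrow> complex poly" and A
      by (induction A rule: infinite_finite_induct) (simp_all add: \<phi>_1 \<phi>_mult)
    have \<phi>_sum: "\<phi> (sum f A) = (\<Sum>i\<in>A. \<phi> (f i))" for f :: "complex \<Rightarrow> complex poly" and A
      by (induction A rule: infinite_finite_induct) (simp_all add: \<phi>_0 \<phi>_add)
    have \<phi>_M: "h = 0" if "\<phi> h \<in> M" for h
      using that
    proof (induction "degree h" arbitrary: h rule: less_induct)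
      case (less h)
      show ?case
      proof (cases "degree h = 0")
        case True
        then obtain a where "h = [:a:]" by (meson degree_eq_zeroE)
        then show ?thesis using less.prems const[of a] by (simp add: \<phi>_pCons \<phi>_0)
      next
        case False
        then obtain g where "poly h g = 0"
          using alg_closed_imp_poly_has_root[of h] by auto
        then obtain k where k: "h = [:- g, 1:] * k"
          by (metis dvdE poly_eq_0_iff_dvd)
        then have "k \<noteq> 0" using False by auto
        have "\<phi> k \<in> M"
          using less.prems prime[of "u - cconst g" "\<phi> k"] not
          unfolding k \<phi>_mult \<phi>_linear u_def by blast
        moreover have "degree k < degree h"
          unfolding k using \<open>k \<noteq> 0\<close> by (subst degree_mult_eq) auto
        ultimately have "k = 0" using less.hyps by blast
        then show ?thesis using \<open>k \<noteq> 0\<close> by simp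
      qed
    qed
    \<comment> \<open>Countably many denominators cannot each serve countably many constants only.\<close>
    have "\<exists>t\<in>Q. uncountable {c. s c = t}"
    proof (rule ccontr)
      assume "\<not> (\<exists>t\<in>Q. uncountable {c. s c = t})"
      then have "countable (\<Union>t\<in>Q. {c. s c = t})" using Q(1) by auto
      moreover have "(\<Union>t\<in>Q. {c. s c = t}) = UNIV" using sr(1) by auto
      ultimately show False using uncountable_UNIV_complex by simp
    qed
    then obtain t where t: "t \<in> Q" "uncountable {c. s c = t}" by blast
    have tM: "t \<notin> M" using t MQ by blast
    define S where "S = {c. s c = t}"
    have r: "t - r c * (u - cconst c) \<in> M" if "c \<in> S" for c
      using sr(2)[of c] that by (simp add: S_def)
    have inj: "inj_on r S"
    proof (rule inj_onI, rule ccontr)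
      fix c d assume cd: "c \<in> S" "d \<in> S" "r c = r d" "c \<noteq> d"
      have "(t - r c * (u - cconst c)) - (t - r d * (u - cconst d)) \<in> M"
        by (intro M_diff r cd)
      then have "cconst (c - d) * r c \<in> M"
        using cd(3) by (simp add: algebra_simps single_diff)
      then have "r c \<in> M" using prime const cd(4) by fastforce
      then have "(t - r c * (u - cconst c)) + (u - cconst c) * r c \<in> M"
        by (intro M_add M_mult r cd)
      then show False using tM by (simp add: algebra_simps)
    qed
    have "\<not> cpoly_vs.independent (r ` S)"
      using countable_independent_cpoly[OF v, of "r ` S"] countable_image_inj_on[OF _ inj] t(2)
      by (auto simp: S_def)
    then obtain B f where B: "finite B" "B \<subseteq> r ` S" "(\<Sum>b\<in>B. cconst (f b) * b) = 0"
      and f: "\<exists>b\<in>B. f b \<noteq> 0"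
      unfolding cpoly_vs.dependent_explicit by blast
    obtain T where T: "T \<subseteq> S" "finite T" "B = r ` T"
      using finite_subset_image[OF B(1,2)] by blast
    have injT: "inj_on r T" using inj T(1) by (rule inj_on_subset)
    define a where "a c = f (r c)" for c
    have a_sum: "(\<Sum>c\<in>T. cconst (a c) * r c) = 0"
      using B(3) unfolding T(3) a_def by (subst (asm) sum.reindex[OF injT]) simp
    obtain c0 where c0: "c0 \<in> T" "a c0 \<noteq> 0"
      using f unfolding T(3) a_def by blast
    \<comment> \<open>The relation \<open>\<Sum> a c / (u - c) = 0\<close>, multiplied by the product of all \<open>u - d\<close>. Its value at \<open>c0\<close>
      comes from the summand \<open>c0\<close> alone.\<close>
    define h where "h = (\<Sum>c\<in>T. smult (a c) (\<Prod>d\<in>T-{c}. [:- d, 1:]))"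
    have "poly h c0 = (\<Sum>c\<in>T. a c * (\<Prod>d\<in>T-{c}. c0 - d))"
      by (simp add: h_def poly_sum poly_prod)
    also have "\<dots> = (\<Sum>c\<in>{c0}. a c * (\<Prod>d\<in>T-{c}. c0 - d))"
      using T(2) c0 by (intro sum.mono_neutral_right) (auto simp: prod_zero_iff)
    also have "\<dots> \<noteq> 0" using c0 T(2) by simp
    finally have "h \<noteq> 0" by auto
    have "(\<Sum>c\<in>T. (cconst (a c) * (\<Prod>d\<in>T-{c}. u - cconst d)) * (t - r c * (u - cconst c))) \<in> M"
      by (intro M_sum M_mult r) (use T in auto)
    also have "(\<Sum>c\<in>T. (cconst (a c) * (\<Prod>d\<in>T-{c}. u - cconst d)) * (t - r c * (u - cconst c))) =
        t * \<phi> h - (\<Sum>c\<in>T. cconst (a c) * r c) * (\<Prod>d\<in>T. u - cconst d)"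
      unfolding h_def \<phi>_sum \<phi>_smult \<phi>_prod \<phi>_linear sum_distrib_left sum_distrib_right
        sum_subtractf[symmetric]
      by (intro sum.cong refl) (simp add: prod.remove[OF T(2)] algebra_simps)
    finally have "t * \<phi> h \<in> M" by (simp add: a_sum)
    then show False using prime tM \<phi>_M \<open>h \<noteq> 0\<close> by blast
  qed
  then obtain z where z: "\<And>v. cvar v - cconst (z v) \<in> M" by metis
  have ev: "p - cconst (peval p z) \<in> M" for p
  proof (induction p rule: cpoly_generated_induct_UNIV)
    case (const c)
    then show ?case using cpoly_ideal.subspace_0[OF ideal] by simp
  next
    case (var v)
    then show ?case using z by simp
  next
    case (add p q)
    then have "(p - cconst (peval p z)) + (q - cconst (peval q z)) \<in> M" by (rule M_add)
    then show ?case by (simp add: peval_add single_add algebra_simps)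
  next
    case (mult p q)
    have "p * (q - cconst (peval q z)) + cconst (peval q z) * (p - cconst (peval p z)) \<in> M"
      by (intro M_add M_mult mult)
    then show ?case by (simp add: peval_mult mult_single algebra_simps)
  qed
  have M_iff: "p \<in> M \<longleftrightarrow> peval p z = 0" for p
  proof
    assume "p \<in> M"
    then have "p - (p - cconst (peval p z)) \<in> M" using ev by (rule M_diff)
    then show "peval p z = 0" using const by simp
  qed (use ev[of p] in simp)
  show ?thesis using M_iff \<open>I \<subseteq> M\<close> MQ by blast
qed

text \<open>
The polynomials over \<open>K\<close> outside the prime ideal \<open>I\<close> form a countable multiplicative set, to which the
previous lemma applies.
\<close>
lemma generic_point_exists:
  fixes I :: "'v::finite cpoly set"
  assumes I: "cpoly_ideal.subspace I" and "1 \<notin> I"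
    and prime: "\<And>p q. p * q \<in> I \<Longrightarrow> p \<in> I \<or> q \<in> I"
    and K: "unital_subring K" "countable K"
  shows "\<exists>\<xi>. (\<forall>p\<in>I. peval p \<xi> = 0) \<and> (\<forall>p. coeffs_in K p \<longrightarrow> peval p \<xi> = 0 \<longrightarrow> p \<in> I)"
proof -
  define Q where "Q = {q. coeffs_in K q \<and> q \<notin> I}"
  have "countable (UNIV :: 'v set)" by (simp add: countable_finite)
  moreover from this have "countable (UNIV :: ('v \<Rightarrow>\<^sub>0 nat) set)"
    using countable_poly_mapping[where 'a='v and K="UNIV :: nat set"] by simp
  then have "countable Q"
    using countable_subset[OF _ countable_poly_mapping[OF _ K(2)], of Q]
    by (auto simp: Q_def coeffs_in_def)
  moreover have "1 \<in> Q"
    using assms(2) coeffs_in_closure(1)[OF K(1), of 1] unital_subringD(2)[OF K(1)]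
    by (simp add: Q_def)
  moreover have "s * t \<in> Q" if "s \<in> Q" "t \<in> Q" for s t
    using that prime coeffs_in_closure(4)[OF K(1)] by (auto simp: Q_def)
  moreover have "I \<inter> Q = {}" by (auto simp: Q_def)
  ultimately obtain z where "\<forall>p\<in>I. peval p z = 0" "\<forall>s\<in>Q. peval s z \<noteq> 0"
    using countable_nullstellensatz[OF _ I] by metis
  then show ?thesis by (auto simp: Q_def)
qed

section \<open>Real orbit maps\<close>

text \<open>
Points of affine space as bare functions, the form in which \<open>peval\<close> and \<open>pdiff\<close> take their arguments.
\<close>
definition coords :: "complex^'n^'n \<Rightarrow> ('n::finite) \<times> 'n \<Rightarrow> complex" where
  "coords g = ($) (entries g)"

lemma coords_apply [simp]: "coords g (i, j) = g $ i $ j"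
  by (simp add: coords_def entries_def)

lemma vanishing_ideal_entries:
  "p \<in> vanishing_ideal (entries ` G) \<longleftrightarrow> (\<forall>g\<in>G. peval p (coords g) = 0)"
  by (auto simp: vanishing_ideal_def coords_def)

lemma subspace_vanishing_ideal: "cpoly_ideal.subspace (vanishing_ideal Z)"
  by (rule cpoly_ideal.subspaceI) (auto simp: vanishing_ideal_def peval_add peval_diff peval_uminus peval_mult)

text \<open>
If \<open>p q\<close> vanishes on \<open>Z\<close>, then \<open>Z\<close> is the union of its closed subsets cut out by \<open>p\<close> and by \<open>q\<close>.
\<close>
lemma irreducible_imp_prime:
  assumes irr: "zariski_irreducible Z" and pq: "p * q \<in> vanishing_ideal Z"
  shows "p \<in> vanishing_ideal Z \<or> q \<in> vanishing_ideal Z"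
proof (rule ccontr)
  assume not: "\<not> ?thesis"
  define W where "W r = zero_set {r} \<inter> Z" for r
  have closed: "closedin (subtopology zariski_topology Z) (W r)" for r
    unfolding closedin_subtopology W_def closedin_zariski zariski_closed_def by blast
  have W: "W r \<subset> Z \<longleftrightarrow> r \<notin> vanishing_ideal Z" for r
    by (auto simp: W_def zero_set_def vanishing_ideal_def)
  have "Z = W p \<union> W q"
    using pq by (auto simp: W_def zero_set_def vanishing_ideal_def peval_mult)
  moreover have "W p \<subset> Z" "W q \<subset> Z"
    using not W by simp_all
  ultimately show False
    using irr closed[of p] closed[of q] unfolding zariski_irreducible_def by metis
qed

definition det_poly :: "('n::finite \<times> 'n) cpoly" where
  "det_poly = (\<Sum>\<sigma>\<in>{\<sigma>. \<sigma> permutes UNIV}. cconst (of_int (sign \<sigma>)) * (\<Prod>i\<in>UNIV. cvar (i, \<sigma> i)))"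

lemma peval_det_poly [simp]: "peval det_poly (coords g) = det g"
  by (simp add: det_poly_def det_def peval_sum peval_mult peval_prod)

definition left_mult :: "complex^'n::finite^'n \<Rightarrow> ('n \<times> 'n \<Rightarrow> complex) \<Rightarrow> 'n \<times> 'n \<Rightarrow> complex" where
  "left_mult g a = (\<lambda>(i, j). \<Sum>l\<in>UNIV. g $ i $ l * a (l, j))"

definition left_mult_poly :: "complex^'n::finite^'n \<Rightarrow> 'n \<times> 'n \<Rightarrow> ('n \<times> 'n) cpoly" where
  "left_mult_poly g = (\<lambda>(i, j). \<Sum>l\<in>UNIV. cconst (g $ i $ l) * cvar (l, j))"

lemma peval_left_mult_poly [simp]: "peval (left_mult_poly g ij) z = left_mult g z ij"
  by (simp add: left_mult_poly_def left_mult_def peval_sum peval_mult split: prod.split)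

lemma pdiff_left_mult_poly [simp]: "pdiff (left_mult_poly g ij) z a = left_mult g a ij"
  by (simp add: left_mult_poly_def left_mult_def pdiff_sum pdiff_mult split: prod.split)

lemma left_mult_coords: "left_mult g (coords h) = coords (g ** h)"
  by (auto simp: fun_eq_iff left_mult_def matrix_matrix_mult_def)

definition cnj_matrix :: "complex^'n^'m \<Rightarrow> complex^'n^'m" where
  "cnj_matrix g = (\<chi> i j. cnj (g $ i $ j))"

lemma cnj_matrix_mult: "cnj_matrix (g ** h) = cnj_matrix g ** cnj_matrix h"
  by (simp add: cnj_matrix_def matrix_matrix_mult_def vec_eq_iff cnj_sum)

lemma cnj_matrix_one [simp]: "cnj_matrix (mat 1) = mat 1"
  by (simp add: cnj_matrix_def mat_def vec_eq_iff)

lemma coords_cnj_matrix: "coords (cnj_matrix g) ij = cnj (coords g ij)"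
  by (cases ij) (simp add: cnj_matrix_def)

text \<open>
The setting of the theorem, with the polynomials \<open>P\<close> that define the action made explicit.
\<close>
locale real_orbit =
  fixes G :: "(complex^'n::finite^'n) set"
    and X :: "(complex^'d::finite) set"
    and act :: "complex^'n^'n \<Rightarrow> complex^'d \<Rightarrow> complex^'d"
    and x :: "complex^'d"
    and P :: "'d \<Rightarrow> (('n \<times> 'n) + 'd) cpoly"
  assumes algebraic: "algebraic_group G"
    and irreducible: "zariski_irreducible (entries ` G)"
    and real_group: "defined_over_reals (entries ` G)"
    and x: "x \<in> real_points X"
    and action: "group_action (GL\<lparr>carrier := G\<rparr>) X act"
    and P_real: "\<And>k. real_cpoly (P k)"
    and act_eq: "\<And>g y k. g \<in> G \<Longrightarrow> y \<in> X \<Longrightarrow>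
      act g y $ k = peval (P k) (case_sum (($) (entries g)) (($) y))"
begin

text \<open>
The closure \<open>Y\<close> of the orbit has the same vanishing ideal as the orbit, so \<open>IY\<close> is the ideal of both.
\<close>
abbreviation "IG \<equiv> vanishing_ideal (entries ` G)"
abbreviation "orb \<equiv> (\<lambda>g. act g x) ` G"
abbreviation "IY \<equiv> vanishing_ideal orb"

lemma x_in_X: "x \<in> X" and x_real: "cnj (x $ k) = x $ k"
  using x by (auto simp: real_points_def Reals_cnj_iff)

lemma G_subgroup: "subgroup G GL"
  using algebraic by (simp add: algebraic_group_def)

lemma one_G: "mat 1 \<in> G"
  using subgroup.one_closed[OF G_subgroup] by (simp add: GL_def)

lemma mult_G: "g \<in> G \<Longrightarrow> h \<in> G \<Longrightarrow> g ** h \<in> G"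
  using subgroup.m_closed[OF G_subgroup, of g h] by (simp add: GL_def)

lemma inverse_G:
  assumes "g \<in> G"
  obtains h where "h \<in> G" "h ** g = mat 1" "g ** h = mat 1"
proof
  have gc: "g \<in> carrier GL" using assms subgroup.subset[OF G_subgroup] by blast
  show "inv\<^bsub>GL\<^esub> g \<in> G" by (rule subgroup.m_inv_closed[OF G_subgroup assms])
  show "(inv\<^bsub>GL\<^esub> g) ** g = mat 1" "g ** (inv\<^bsub>GL\<^esub> g) = mat 1"
    using group.l_inv[OF group_GL gc] group.r_inv[OF group_GL gc] by (simp_all add: GL_def)
qed

lemma IG_iff: "p \<in> IG \<longleftrightarrow> (\<forall>g\<in>G. peval p (coords g) = 0)"
  by (rule vanishing_ideal_entries)

text \<open>
\<open>G\<close> is cut out of the general linear group by its full vanishing ideal.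
\<close>
lemma mem_G_iff: "g \<in> G \<longleftrightarrow> invertible g \<and> (\<forall>p\<in>IG. peval p (coords g) = 0)"
proof
  assume "g \<in> G"
  then show "invertible g \<and> (\<forall>p\<in>IG. peval p (coords g) = 0)"
    using subgroup.subset[OF G_subgroup] by (auto simp: GL_def IG_iff)
next
  assume g: "invertible g \<and> (\<forall>p\<in>IG. peval p (coords g) = 0)"
  obtain S where S: "G = {g \<in> carrier GL. entries g \<in> zero_set S}"
    using algebraic by (auto simp: algebraic_group_def)
  then have "S \<subseteq> IG" by (auto simp: zero_set_def vanishing_ideal_def)
  with g show "g \<in> G" unfolding S by (auto simp: GL_def zero_set_def coords_def)
qed

lemma act_X: "g \<in> G \<Longrightarrow> y \<in> X \<Longrightarrow> act g y \<in> X"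
  using group_action.element_image[OF action, of g y] by simp

lemma act_mult: "g \<in> G \<Longrightarrow> h \<in> G \<Longrightarrow> y \<in> X \<Longrightarrow> act (g ** h) y = act g (act h y)"
  using group_action.composition_rule[OF action, of y g h] by (simp add: GL_def)

lemma act_one: "y \<in> X \<Longrightarrow> act (mat 1) y = y"
  using group_action.id_eq_one[OF action]
  by (metis (no_types, lifting) GL_def monoid.simps(2) monoid.update_convs(1)
      partial_object.update_convs(1) restrict_apply')

definition act_poly :: "complex^'n^'n \<Rightarrow> 'd \<Rightarrow> 'd cpoly" where
  "act_poly g k = psubst (case_sum (\<lambda>ij. cconst (coords g ij)) cvar) (P k)"

definition orbit_poly :: "'d \<Rightarrow> ('n \<times> 'n) cpoly" where
  "orbit_poly k = psubst (case_sum cvar (\<lambda>k. cconst (x $ k))) (P k)"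

lemma peval_act_poly: "g \<in> G \<Longrightarrow> y \<in> X \<Longrightarrow> peval (act_poly g k) (($) y) = act g y $ k"
proof -
  have "(\<lambda>v. peval (case_sum (\<lambda>ij. cconst (coords g ij)) cvar v) (($) y)) = case_sum (($) (entries g)) (($) y)"
    by (auto simp: fun_eq_iff coords_def split: sum.split)
  then show "g \<in> G \<Longrightarrow> y \<in> X \<Longrightarrow> ?thesis" by (simp add: act_poly_def act_eq)
qed

lemma peval_orbit_poly: "g \<in> G \<Longrightarrow> peval (orbit_poly k) (coords g) = act g x $ k"
proof -
  have "(\<lambda>v. peval (case_sum cvar (\<lambda>k. cconst (x $ k)) v) (coords g)) = case_sum (($) (entries g)) (($) x)"
    by (auto simp: fun_eq_iff coords_def split: sum.split)
  then show "g \<in> G \<Longrightarrow> ?thesis" by (simp add: orbit_poly_def act_eq x_in_X)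
qed

lemma peval_act_poly': "g \<in> G \<Longrightarrow> y \<in> X \<Longrightarrow> (\<lambda>k. peval (act_poly g k) (($) y)) = ($) (act g y)"
  and peval_orbit_poly': "g \<in> G \<Longrightarrow> (\<lambda>k. peval (orbit_poly k) (coords g)) = ($) (act g x)"
  by (simp_all add: fun_eq_iff peval_act_poly peval_orbit_poly)

lemma IY_iff: "p \<in> IY \<longleftrightarrow> (\<forall>g\<in>G. peval p (($) (act g x)) = 0)"
  by (auto simp: vanishing_ideal_def)

lemma act_orb: "g \<in> G \<Longrightarrow> h \<in> G \<Longrightarrow> act g (act h x) = act (g ** h) x"
  by (simp add: act_mult x_in_X)

lemma IY_translate: "g \<in> G \<Longrightarrow> p \<in> IY \<Longrightarrow> psubst (act_poly g) p \<in> IY"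
  by (simp add: IY_iff peval_act_poly' act_X x_in_X act_orb mult_G)

lemma IG_translate: "g \<in> G \<Longrightarrow> p \<in> IG \<Longrightarrow> psubst (left_mult_poly g) p \<in> IG"
  by (simp add: IG_iff left_mult_coords mult_G)

section \<open>Surjectivity of the differential of the orbit map\<close>

text \<open>
Choosing a countable spanning set of the ideal of \<open>G\<close> and putting its coefficients into \<open>K\<close> makes
\<open>G\<close> defined over \<open>K\<close>. The determinant is included among the polynomials over \<open>K\<close> so that it does not
vanish at the generic point, which therefore lies in \<open>G\<close>.
\<close>
lemma generic_element_exists:
  "\<exists>K \<xi>. unital_subring K \<and> (\<forall>k. coeffs_in K (orbit_poly k)) \<and> \<xi> \<in> G \<and>
     (\<forall>p. coeffs_in K p \<longrightarrow> peval p (coords \<xi>) = 0 \<longrightarrow> p \<in> IG) \<and>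
     (\<exists>B\<subseteq>IG. (\<forall>p\<in>B. coeffs_in K p) \<and> IG \<subseteq> cpoly_vs.span B)"
proof -
  obtain B where B: "B \<subseteq> IG" "countable B" "IG \<subseteq> cpoly_vs.span B"
    using countable_spanning_subset[of IG] by (auto simp: countable_finite)
  define L where "L = (\<Union>p \<in> insert det_poly (B \<union> range orbit_poly). range (Poly_Mapping.lookup p))"
  have "countable (range (Poly_Mapping.lookup p))" for p :: "('n \<times> 'n) cpoly"
  proof (rule countable_subset)
    show "range (Poly_Mapping.lookup p) \<subseteq> insert 0 (Poly_Mapping.lookup p ` Poly_Mapping.keys p)"
      by (auto simp: in_keys_iff)
  qed (simp add: countable_finite)
  then have "countable L"
    unfolding L_def using B(2) by (intro countable_UN) (auto simp: countable_finite)
  then obtain K where K: "unital_subring K" "countable K" "L \<subseteq> K"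
    using countable_subring_hull by blast
  have coeffs: "coeffs_in K p" if "p \<in> insert det_poly (B \<union> range orbit_poly)" for p
    using K(3) that unfolding coeffs_in_def L_def by blast
  have "1 \<notin> IG" using one_G by (auto simp: IG_iff)
  then obtain z where z: "\<And>p. p \<in> IG \<Longrightarrow> peval p z = 0"
      "\<And>p. coeffs_in K p \<Longrightarrow> peval p z = 0 \<Longrightarrow> p \<in> IG"
    using generic_point_exists[OF subspace_vanishing_ideal _ irreducible_imp_prime[OF irreducible] K(1,2)]
    by blast
  define \<xi> :: "complex^'n^'n" where "\<xi> = (\<chi> i j. z (i, j))"
  have coords: "coords \<xi> = z" by (auto simp: fun_eq_iff \<xi>_def)
  have "det_poly \<notin> IG" using one_G by (auto simp: IG_iff intro!: bexI[of _ "mat 1"])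
  then have "det \<xi> \<noteq> 0"
    using z(2)[of det_poly] coeffs[of det_poly] unfolding coords[symmetric] by auto
  then have "\<xi> \<in> G"
    unfolding mem_G_iff coords invertible_det_nz using z(1) by blast
  then show ?thesis
    using K(1) B(1,3) z(2) coeffs unfolding coords[symmetric] by blast
qed

text \<open>
The Zariski tangent spaces of \<open>G\<close> at the identity and of the orbit closure at \<open>x\<close>.
\<close>
definition tangent_G :: "(('n \<times> 'n) \<Rightarrow> complex) set" where
  "tangent_G = {a. \<forall>p\<in>IG. pdiff p (coords (mat 1)) a = 0}"

definition tangent_Y :: "('d \<Rightarrow> complex) set" where
  "tangent_Y = {v. \<forall>p\<in>IY. pdiff p (($) x) v = 0}"

text \<open>
With \<open>\<xi>\<close> generic, move \<open>v\<close> to a tangent vector \<open>w\<close> at \<open>\<xi> \<cdot> x\<close>, lift \<open>w\<close> to a tangent vector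
\<open>a\<close> of \<open>G\<close> at \<open>\<xi>\<close>, and translate \<open>a\<close> back to the identity by \<open>\<eta> = \<xi>\<inverse>\<close>. That the result lies over
\<open>v\<close> follows by differentiating \<open>(\<eta> g) \<cdot> x = \<eta> \<cdot> (g \<cdot> x)\<close> at \<open>\<xi>\<close> and \<open>\<eta> \<cdot> (\<xi> \<cdot> y) = y\<close> at \<open>x\<close>.
\<close>
lemma orbit_differential_surj:
  assumes v: "v \<in> tangent_Y"
  shows "\<exists>a\<in>tangent_G. \<forall>k. pdiff (orbit_poly k) (coords (mat 1)) a = v k"
proof -
  obtain K \<xi> B where K: "unital_subring K" and F: "\<And>k. coeffs_in K (orbit_poly k)"
    and \<xi>: "\<xi> \<in> G" and generic: "\<And>p. coeffs_in K p \<Longrightarrow> peval p (coords \<xi>) = 0 \<Longrightarrow> p \<in> IG"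
    and B: "B \<subseteq> IG" "\<And>p. p \<in> B \<Longrightarrow> coeffs_in K p" "IG \<subseteq> cpoly_vs.span B"
    using generic_element_exists by blast
  define w where "w k = pdiff (act_poly \<xi> k) (($) x) v" for k
  have w: "pdiff p (($) (act \<xi> x)) w = 0" if p: "coeffs_in K p" "peval p (($) (act \<xi> x)) = 0" for p
  proof -
    obtain r where r: "coeffs_in K r" "\<And>z. peval r z = peval p (\<lambda>k. peval (orbit_poly k) z)"
      using subst_exists[OF p(1) K, of orbit_poly] F by blast
    have "r \<in> IG"
      by (rule generic[OF r(1)]) (simp add: r(2) peval_orbit_poly' \<xi> p(2))
    then have "p \<in> IY"
      by (simp add: IG_iff IY_iff r(2) peval_orbit_poly')
    then have "pdiff (psubst (act_poly \<xi>) p) (($) x) v = 0"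
      using v IY_translate[OF \<xi>] unfolding tangent_Y_def by blast
    then show ?thesis
      by (simp add: peval_act_poly' \<xi> x_in_X w_def[abs_def])
  qed
  obtain a where a: "\<And>p. coeffs_in K p \<Longrightarrow> peval p (coords \<xi>) = 0 \<Longrightarrow> pdiff p (coords \<xi>) a = 0"
      "\<And>k. pdiff (orbit_poly k) (coords \<xi>) a = w k"
    using tangent_lift[of K orbit_poly "coords \<xi>" w, OF K F] w unfolding peval_orbit_poly'[OF \<xi>] by blast
  have tangent: "pdiff p (coords \<xi>) a = 0" if "p \<in> IG" for p
  proof -
    have "p \<in> cpoly_vs.span B" using B(3) that by blast
    then show ?thesis
    proof (induction p rule: cpoly_vs.span_induct_alt)
      case (step c b q)
      have "peval b (coords \<xi>) = 0" using step(1) B(1) \<xi> by (auto simp: IG_iff)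
      then show ?case using step a(1) B(2) by (simp add: pdiff_add pdiff_diff pdiff_uminus pdiff_mult)
    qed simp
  qed
  obtain \<eta> where \<eta>: "\<eta> \<in> G" "\<eta> ** \<xi> = mat 1" by (rule inverse_G[OF \<xi>])
  define b where "b = left_mult \<eta> a"
  have "b \<in> tangent_G"
    unfolding tangent_G_def
  proof (intro CollectI ballI)
    fix p assume "p \<in> IG"
    then have "pdiff (psubst (left_mult_poly \<eta>) p) (coords \<xi>) a = 0"
      using tangent IG_translate[OF \<eta>(1)] by blast
    then show "pdiff p (coords (mat 1)) b = 0"
      by (simp add: left_mult_coords \<eta>(2) b_def)
  qed
  moreover have "pdiff (orbit_poly k) (coords (mat 1)) b = v k" for k
  proof -
    have "psubst (left_mult_poly \<eta>) (orbit_poly k) - psubst orbit_poly (act_poly \<eta> k) \<in> IG"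
      using \<eta>(1) by (simp add: IG_iff peval_add peval_diff peval_uminus peval_mult left_mult_coords peval_orbit_poly mult_G
          peval_orbit_poly' peval_act_poly act_X x_in_X act_mult)
    from tangent[OF this]
    have "pdiff (orbit_poly k) (coords (mat 1)) b = pdiff (act_poly \<eta> k) (($) (act \<xi> x)) w"
      by (simp add: pdiff_add pdiff_diff pdiff_uminus pdiff_mult left_mult_coords \<eta>(2) b_def peval_orbit_poly' \<xi> a(2))
    moreover have "psubst (act_poly \<xi>) (act_poly \<eta> k) - cvar k \<in> IY"
      using \<xi> \<eta> by (simp add: IY_iff peval_add peval_diff peval_uminus peval_mult peval_act_poly' peval_act_poly
          act_X x_in_X act_orb mult_G matrix_mul_assoc)
    then have "pdiff (psubst (act_poly \<xi>) (act_poly \<eta> k) - cvar k) (($) x) v = 0"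
      using v by (auto simp: tangent_Y_def)
    then have "pdiff (act_poly \<eta> k) (($) (act \<xi> x)) w = v k"
      by (simp add: pdiff_add pdiff_diff pdiff_uminus pdiff_mult peval_act_poly' \<xi> x_in_X w_def[abs_def])
    ultimately show ?thesis by simp
  qed
  ultimately show ?thesis by blast
qed

section \<open>Descent to real tangent vectors\<close>

text \<open>
This is where the real structure of \<open>G\<close> enters: real generators of its ideal take conjugate values
at conjugate points.
\<close>
lemma IG_cnj:
  assumes "p \<in> IG" "g \<in> G" shows "peval p (\<lambda>ij. cnj (coords g ij)) = 0"
proof -
  obtain B where B: "\<And>p. p \<in> B \<Longrightarrow> real_cpoly p" "IG = cpoly_ideal.span B"
    using real_group by (auto simp: defined_over_reals_def)
  have "p \<in> cpoly_ideal.span B" using assms(1) B(2) by simp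
  then show ?thesis
  proof (induction p rule: cpoly_ideal.span_induct_alt)
    case (step r b q)
    have "b \<in> IG" using step(1) B(2) cpoly_ideal.span_base by blast
    then have "peval b (coords g) = 0" using assms(2) by (simp add: IG_iff)
    then have "peval b (\<lambda>ij. cnj (coords g ij)) = 0"
      using real_function_real_cpoly[OF B(1)[OF step(1)]] by (simp add: real_function_def)
    then show ?case using step by (simp add: peval_add peval_diff peval_uminus peval_mult)
  qed simp
qed

lemma pcnj_IG: "p \<in> IG \<Longrightarrow> pcnj p \<in> IG"
  using IG_cnj by (simp add: IG_iff[of "pcnj p"] peval_pcnj)

lemma cnj_matrix_G:
  assumes "g \<in> G"
  shows "cnj_matrix g \<in> G"
proof -
  obtain h where "h ** g = mat 1" "g ** h = mat 1" by (rule inverse_G[OF assms])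
  then have "invertible (cnj_matrix g)"
    unfolding invertible_def by (metis cnj_matrix_mult cnj_matrix_one)
  moreover have "coords (cnj_matrix g) = (\<lambda>ij. cnj (coords g ij))"
    by (simp add: fun_eq_iff coords_cnj_matrix)
  moreover have "peval p (coords (cnj_matrix g)) = 0" if "p \<in> IG" for p
    unfolding calculation(2) by (rule IG_cnj[OF that assms])
  ultimately show ?thesis
    unfolding mem_G_iff by blast
qed

lemma orbit_poly_real: "real_function (orbit_poly k)"
proof -
  have "(\<lambda>v. peval (case_sum cvar (\<lambda>k. cconst (x $ k)) v) (\<lambda>v. cnj (z v))) =
      (\<lambda>v. cnj (peval (case_sum cvar (\<lambda>k. cconst (x $ k)) v) z))" for z
    by (auto simp: fun_eq_iff x_real split: sum.split)
  note eq = this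
  show ?thesis
    unfolding real_function_def orbit_poly_def peval_psubst eq
    using real_function_real_cpoly[OF P_real[of k]] unfolding real_function_def by simp
qed

lemma cnj_act_x: "g \<in> G \<Longrightarrow> cnj (act g x $ k) = act (cnj_matrix g) x $ k"
proof -
  assume g: "g \<in> G"
  have "coords (cnj_matrix g) = (\<lambda>ij. cnj (coords g ij))"
    by (simp add: fun_eq_iff coords_cnj_matrix)
  then show ?thesis
    using orbit_poly_real[of k] peval_orbit_poly[OF g, of k] peval_orbit_poly[OF cnj_matrix_G[OF g], of k]
    by (simp add: real_function_def)
qed

lemma pcnj_IY: "p \<in> IY \<Longrightarrow> pcnj p \<in> IY"
  by (simp add: IY_iff peval_pcnj cnj_act_x cnj_matrix_G)

text \<open>
The ideal of the orbit is stable under conjugation, hence spanned over \<open>\<complex>\<close> by its real elements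
\<open>(p + p\<^sup>*) / 2\<close> and \<open>(p - p\<^sup>*) / 2\<i>\<close>.
\<close>
lemma tangent_Y_real:
  fixes v :: "'d \<Rightarrow> real"
  assumes v: "\<And>p. p \<in> IY \<Longrightarrow> real_function p \<Longrightarrow> pdiff p (($) x) (\<lambda>k. of_real (v k)) = 0"
  shows "(\<lambda>k. of_real (v k)) \<in> tangent_Y"
  unfolding tangent_Y_def
proof (intro CollectI ballI)
  fix p assume p: "p \<in> IY"
  define q where "q = cconst (1/2) * (p + pcnj p)"
  define r where "r = cconst (1/(2*\<i>)) * (p - pcnj p)"
  have "q \<in> IY" "r \<in> IY"
    using p pcnj_IY[OF p] by (simp_all add: IY_iff q_def r_def peval_add peval_diff peval_uminus peval_mult)
  moreover have "real_function q" "real_function r"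
    by (simp_all add: real_function_def q_def r_def peval_add peval_diff peval_uminus peval_mult peval_pcnj algebra_simps)
  ultimately have "pdiff q (($) x) (\<lambda>k. of_real (v k)) = 0" "pdiff r (($) x) (\<lambda>k. of_real (v k)) = 0"
    using v by blast+
  moreover have "pdiff p (($) x) (\<lambda>k. of_real (v k)) =
      pdiff q (($) x) (\<lambda>k. of_real (v k)) + \<i> * pdiff r (($) x) (\<lambda>k. of_real (v k))"
    by (simp add: q_def r_def pdiff_add pdiff_diff pdiff_uminus pdiff_mult algebra_simps)
  ultimately show "pdiff p (($) x) (\<lambda>k. of_real (v k)) = 0" by simp
qed

text \<open>
The real part of a complex solution is again a solution, by linearity and invariance under conjugation.
\<close>
lemma real_orbit_differential_surj:
  fixes v :: "'d \<Rightarrow> real"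
  assumes v: "\<And>p. p \<in> IY \<Longrightarrow> real_function p \<Longrightarrow> pdiff p (($) x) (\<lambda>k. of_real (v k)) = 0"
  shows "\<exists>a :: 'n \<times> 'n \<Rightarrow> real. (\<lambda>ij. of_real (a ij)) \<in> tangent_G \<and>
    (\<forall>k. pdiff (orbit_poly k) (coords (mat 1)) (\<lambda>ij. of_real (a ij)) = of_real (v k))"
proof -
  obtain a where a: "a \<in> tangent_G" "\<And>k. pdiff (orbit_poly k) (coords (mat 1)) a = of_real (v k)"
    using orbit_differential_surj[OF tangent_Y_real[OF v]] by blast
  have one: "(\<lambda>ij. cnj (coords (mat 1 :: complex^'n^'n) ij)) = coords (mat 1)"
    using coords_cnj_matrix[of "mat 1 :: complex^'n^'n"] by (simp add: fun_eq_iff)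
  have re: "(\<lambda>ij. complex_of_real (Re (a ij))) = (\<lambda>ij. 1/2 * a ij + 1/2 * cnj (a ij))"
    by (auto simp: fun_eq_iff complex_eq_iff)
  have "pdiff p (coords (mat 1)) (\<lambda>ij. cnj (a ij)) = 0" if "p \<in> IG" for p
    using pdiff_pcnj[of p "coords (mat 1)" a] a(1) pcnj_IG[OF that] unfolding one
    by (auto simp: tangent_G_def)
  then have "(\<lambda>ij. of_real (Re (a ij))) \<in> tangent_G"
    using a(1) unfolding re tangent_G_def mem_Collect_eq pdiff_linear by simp
  moreover have "pdiff (orbit_poly k) (coords (mat 1)) (\<lambda>ij. cnj (a ij)) = of_real (v k)" for k
    using real_function_pdiff[OF orbit_poly_real[of k], of "coords (mat 1)" a] a(2) unfolding one by simp
  then have "pdiff (orbit_poly k) (coords (mat 1)) (\<lambda>ij. of_real (Re (a ij))) = of_real (v k)" for k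
    unfolding re pdiff_linear a(2) by simp
  ultimately show ?thesis by (intro exI[of _ "\<lambda>ij. Re (a ij)"]) simp
qed

end

section \<open>One-parameter subgroups\<close>

text \<open>
The matrix exponential \<open>exp(tA)\<close>, defined entrywise by its power series.
\<close>
lemma matrix_exponential_exists:
  fixes A :: "complex^'n::finite^'n"
  shows "\<exists>E :: complex \<Rightarrow> complex^'n^'n. E 0 = mat 1 \<and>
    (\<forall>t i j. ((\<lambda>t. E t $ i $ j) has_field_derivative (E t ** A) $ i $ j) (at t)) \<and>
    (cnj_matrix A = A \<longrightarrow> (\<forall>t. cnj t = t \<longrightarrow> cnj_matrix (E t) = E t))"
proof -
  define M :: "nat \<Rightarrow> complex^'n^'n" where "M = rec_nat (mat 1) (\<lambda>_ B. B ** A)"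
  have M_0: "M 0 = mat 1" and M_Suc: "M (Suc k) = M k ** A" for k
    by (simp_all add: M_def)
  define c where "c = (\<Sum>i\<in>UNIV. \<Sum>j\<in>UNIV. norm (A $ i $ j))"
  have "c \<ge> 0" by (auto simp: c_def intro!: sum_nonneg)
  have bound: "norm (M k $ i $ j) \<le> c ^ k" for k i j
  proof (induction k arbitrary: i j)
    case 0
    then show ?case by (simp add: M_0 mat_def)
  next
    case (Suc k)
    have "norm (M (Suc k) $ i $ j) \<le> (\<Sum>l\<in>UNIV. norm (M k $ i $ l * A $ l $ j))"
      unfolding M_Suc matrix_matrix_mult_def by (simp add: norm_sum)
    also have "\<dots> \<le> (\<Sum>l\<in>UNIV. c ^ k * norm (A $ l $ j))"
      by (intro sum_mono) (use Suc in \<open>auto simp: norm_mult intro!: mult_right_mono\<close>)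
    also have "\<dots> = c ^ k * (\<Sum>l\<in>UNIV. norm (A $ l $ j))" by (simp add: sum_distrib_left)
    also have "\<dots> \<le> c ^ k * c"
      unfolding c_def using \<open>c \<ge> 0\<close>
      by (intro mult_left_mono sum_mono member_le_sum) (auto simp: c_def)
    finally show ?case by (simp add: mult.commute)
  qed
  define a where "a i j k = M k $ i $ j / fact k" for i j k
  define E :: "complex \<Rightarrow> complex^'n^'n" where "E t = (\<chi> i j. suminf (\<lambda>k. a i j k * t ^ k))" for t
  have summ: "summable (\<lambda>k. a i j k * t ^ k)" for i j t
  proof (rule summable_comparison_test)
    show "\<exists>N. \<forall>n\<ge>N. norm (a i j n * t ^ n) \<le> (c * norm t) ^ n /\<^sub>R fact n"
    proof (intro exI allI impI)
      fix n
      have "norm (a i j n * t ^ n) = norm (M n $ i $ j) * (norm t ^ n / fact n)"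
        by (simp add: a_def norm_mult norm_divide norm_power)
      also have "\<dots> \<le> c ^ n * (norm t ^ n / fact n)"
        by (intro mult_right_mono bound) simp
      finally show "norm (a i j n * t ^ n) \<le> (c * norm t) ^ n /\<^sub>R fact n"
        by (simp add: power_mult_distrib divide_inverse mult_ac)
    qed
    show "summable (\<lambda>n. (c * norm t) ^ n /\<^sub>R fact n)"
      by (rule summable_exp_generic)
  qed
  have "E 0 = mat 1"
    unfolding E_def powser_zero by (simp add: a_def M_0)
  moreover have "((\<lambda>t. E t $ i $ j) has_field_derivative (E t ** A) $ i $ j) (at t)" for t i j
  proof -
    have "diffs (a i j) k = (\<Sum>l\<in>UNIV. a i l k * A $ l $ j)" for k
    proof -
      have "diffs (a i j) k = M (Suc k) $ i $ j / fact k"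
        by (simp add: diffs_def a_def fact_Suc divide_simps del: of_nat_Suc)
      also have "\<dots> = (\<Sum>l\<in>UNIV. a i l k * A $ l $ j)"
        unfolding M_Suc matrix_matrix_mult_def by (simp add: a_def sum_divide_distrib)
      finally show ?thesis .
    qed
    then have "suminf (\<lambda>k. diffs (a i j) k * t ^ k) =
        suminf (\<lambda>k. \<Sum>l\<in>UNIV. (a i l k * t ^ k) * A $ l $ j)"
      by (simp add: sum_distrib_left mult_ac)
    also have "\<dots> = (\<Sum>l\<in>UNIV. suminf (\<lambda>k. (a i l k * t ^ k) * A $ l $ j))"
      by (intro suminf_sum summable_mult2 summ)
    also have "\<dots> = (E t ** A) $ i $ j"
      by (simp add: matrix_matrix_mult_def E_def suminf_mult2[OF summ])
    finally show ?thesis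
      using termdiffs_strong_converges_everywhere[OF summ, of i j t] by (simp add: E_def)
  qed
  moreover have "cnj_matrix (E t) = E t" if A: "cnj_matrix A = A" and t: "cnj t = t" for t
  proof -
    have "cnj_matrix (M k) = M k" for k
      by (induction k) (simp_all add: M_0 M_Suc cnj_matrix_mult A)
    then have "cnj (M k $ i $ j) = M k $ i $ j" for k i j
      by (metis cnj_matrix_def vec_lambda_beta)
    then have "cnj (a i j k * t ^ k) = a i j k * t ^ k" for i j k
      by (simp add: a_def t)
    then have "cnj (suminf (\<lambda>k. a i j k * t ^ k)) = suminf (\<lambda>k. a i j k * t ^ k)" for i j
      using summ[of i j t] sums_cnj[of "\<lambda>k. a i j k * t ^ k" "suminf (\<lambda>k. a i j k * t ^ k)"]
      by (metis (no_types, lifting) sums_cong sums_unique2 summable_sums)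
    then show ?thesis by (simp add: cnj_matrix_def E_def vec_eq_iff)
  qed
  ultimately show ?thesis by (intro exI[of _ E]) simp
qed

context real_orbit begin

text \<open>
Let \<open>V\<close> be the derivation of the polynomial ring given by the left invariant vector field \<open>g \<mapsto> g A\<close>.
It preserves the ideal of \<open>G\<close>, because at \<open>g \<in> G\<close> the value of \<open>V p\<close> is the derivative at the
identity, in direction \<open>A\<close>, of the left translate of \<open>p\<close> by \<open>g\<close>. Hence all derivatives at \<open>0\<close> of
the entire function \<open>t \<mapsto> p(exp(tA))\<close> vanish.
\<close>
lemma exponential_in_zero_set:
  fixes E :: "complex \<Rightarrow> complex^'n^'n"
  assumes A: "coords A \<in> tangent_G" and E0: "E 0 = mat 1"
    and E: "\<And>t i j. ((\<lambda>t. E t $ i $ j) has_field_derivative (E t ** A) $ i $ j) (at t)"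
    and p: "p \<in> IG"
  shows "peval p (coords (E t)) = 0"
proof -
  define W :: "'n \<times> 'n \<Rightarrow> ('n \<times> 'n) cpoly" where "W = (\<lambda>(i, j). \<Sum>l\<in>UNIV. cvar (i, l) * cconst (A $ l $ j))"
  have W: "peval (W ij) (coords g) = coords (g ** A) ij" for g ij
    by (cases ij) (simp add: W_def peval_sum peval_mult matrix_matrix_mult_def)
  obtain V where V: "\<And>p z. peval (V p) z = pdiff p z (\<lambda>v. peval (W v) z)"
    using pdiff_field_poly_exists[of _ W] by metis
  have V_coords: "peval (V p) (coords g) = pdiff p (coords g) (coords (g ** A))" for p g
    by (simp add: V W)
  have V_IG: "V p \<in> IG" if "p \<in> IG" for p
    unfolding IG_iff V_coords
  proof
    fix g assume "g \<in> G"
    then have "pdiff (psubst (left_mult_poly g) p) (coords (mat 1)) (coords A) = 0"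
      using A IG_translate that unfolding tangent_G_def by blast
    then show "pdiff p (coords g) (coords (g ** A)) = 0"
      by (simp add: left_mult_coords)
  qed
  define h where "h n t = peval ((V ^^ n) p) (coords (E t))" for n t
  have h: "(h n has_field_derivative h (Suc n) t) (at t)" for n t
  proof -
    have "((\<lambda>t. coords (E t) ij) has_field_derivative coords (E t ** A) ij) (at t)" for ij
      using E by (cases ij) simp
    from has_field_derivative_peval_curve[OF this]
    show ?thesis by (simp add: h_def[abs_def] V_coords)
  qed
  have "deriv (h n) = h (Suc n)" for n
    using h by (auto simp: fun_eq_iff intro: DERIV_imp_deriv)
  then have "(deriv ^^ n) (h 0) = h n" for n
    by (induction n) simp_all
  moreover have "h n 0 = 0" for n
  proof -
    have "(V ^^ n) p \<in> IG" by (induction n) (simp_all add: p V_IG)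
    then show ?thesis using one_G by (simp add: h_def E0 IG_iff)
  qed
  moreover have "h 0 holomorphic_on UNIV"
    using h by (intro holomorphic_onI) (auto simp: field_differentiable_def)
  ultimately have "h 0 t = 0"
    using holomorphic_fun_eq_0_on_connected[of "h 0" UNIV 0 t]
    by (simp add: convex_connected)
  then show ?thesis by (simp add: h_def)
qed

lemma real_matrices_iff: "g \<in> real_matrices G \<longleftrightarrow> g \<in> G \<and> cnj_matrix g = g"
  by (auto simp: real_matrices_def cnj_matrix_def vec_eq_iff Reals_cnj_iff)

lemma real_curve_exists:
  fixes a :: "'n \<times> 'n \<Rightarrow> real"
  assumes a: "(\<lambda>ij. of_real (a ij)) \<in> tangent_G"
  shows "\<exists>\<gamma> :: real \<Rightarrow> complex^'n^'n. \<gamma> 0 = mat 1 \<and>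
    (\<forall>i j. continuous_on UNIV (\<lambda>t. \<gamma> t $ i $ j)) \<and>
    (\<forall>i j. ((\<lambda>t. \<gamma> t $ i $ j) has_derivative (\<lambda>h. of_real h * of_real (a (i, j)))) (at 0)) \<and>
    (\<forall>\<^sub>F t in nhds 0. \<gamma> t \<in> real_matrices G)"
proof -
  define A :: "complex^'n^'n" where "A = (\<chi> i j. of_real (a (i, j)))"
  have coords: "coords A = (\<lambda>ij. of_real (a ij))" by (auto simp: fun_eq_iff A_def)
  obtain E :: "complex \<Rightarrow> complex^'n^'n" where E0: "E 0 = mat 1"
    and E: "\<And>t i j. ((\<lambda>t. E t $ i $ j) has_field_derivative (E t ** A) $ i $ j) (at t)"
    and real: "cnj_matrix A = A \<longrightarrow> (\<forall>t. cnj t = t \<longrightarrow> cnj_matrix (E t) = E t)"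
    using matrix_exponential_exists[of A] by blast
  have A_real: "cnj_matrix A = A" by (simp add: cnj_matrix_def A_def)
  define \<gamma> where "\<gamma> t = E (of_real t)" for t
  have cont: "continuous_on UNIV (\<lambda>t. \<gamma> t $ i $ j)" for i j
  proof -
    have "continuous_on UNIV (\<lambda>t. E t $ i $ j)"
      by (rule DERIV_continuous_on) (rule E)
    then show ?thesis
      unfolding \<gamma>_def by (rule continuous_on_compose2) (auto intro!: continuous_intros)
  qed
  have "((\<lambda>t. \<gamma> t $ i $ j) has_derivative (\<lambda>h. of_real h * of_real (a (i, j)))) (at 0)" for i j
  proof -
    have "((\<lambda>t. E t $ i $ j) has_derivative (\<lambda>h. A $ i $ j * h)) (at (of_real 0))"
      using E[of i j 0] by (simp add: E0 has_field_derivative_def)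
    from has_derivative_compose[OF bounded_linear_imp_has_derivative[OF bounded_linear_of_real] this]
    show ?thesis by (simp add: \<gamma>_def A_def mult.commute)
  qed
  moreover have "\<forall>\<^sub>F t in nhds 0. \<gamma> t \<in> real_matrices G"
  proof -
    have "continuous_on UNIV (\<lambda>t. peval det_poly (coords (\<gamma> t)))"
      by (rule continuous_on_peval) (auto simp: cont split: prod.splits)
    then have "open ((\<lambda>t. det (\<gamma> t)) -` (- {0}))"
      by (intro open_vimage) auto
    moreover have "0 \<in> (\<lambda>t. det (\<gamma> t)) -` (- {0})" by (simp add: \<gamma>_def E0)
    ultimately have "\<forall>\<^sub>F t in nhds 0. det (\<gamma> t) \<noteq> 0"
      unfolding eventually_nhds by blast
    then show ?thesis
    proof eventually_elim
      case (elim t)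
      have "\<gamma> t \<in> G"
        unfolding mem_G_iff invertible_det_nz \<gamma>_def
        using elim exponential_in_zero_set[of A E] a E E0 by (simp add: coords \<gamma>_def)
      then show ?case using real A_real by (simp add: real_matrices_iff \<gamma>_def)
    qed
  qed
  ultimately show ?thesis
    using cont by (intro exI[of _ \<gamma>]) (simp add: \<gamma>_def E0)
qed

text \<open>
The product of the curves belonging to the single tangent vectors, with differential at \<open>0\<close> the linear
combination of these vectors.
\<close>
lemma real_chart_exists:
  fixes a :: "'d \<Rightarrow> 'n \<times> 'n \<Rightarrow> real"
  assumes a: "\<And>k. (\<lambda>ij. of_real (a k ij)) \<in> tangent_G"
  shows "\<exists>u :: real^'d \<Rightarrow> complex^'n^'n. u 0 = mat 1 \<and>
    (\<forall>i j. continuous_on UNIV (\<lambda>t. u t $ i $ j)) \<and>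
    (\<forall>i j. ((\<lambda>t. u t $ i $ j) has_derivative (\<lambda>h. \<Sum>k\<in>UNIV. of_real (h $ k) * of_real (a k (i, j)))) (at 0)) \<and>
    (\<forall>\<^sub>F t in nhds 0. u t \<in> real_matrices G)"
proof -
  have "\<exists>u :: real^'d \<Rightarrow> complex^'n^'n. u 0 = mat 1 \<and>
    (\<forall>i j. continuous_on UNIV (\<lambda>t. u t $ i $ j)) \<and>
    (\<forall>i j. ((\<lambda>t. u t $ i $ j) has_derivative (\<lambda>h. \<Sum>k\<in>J. of_real (h $ k) * of_real (a k (i, j)))) (at 0)) \<and>
    (\<forall>\<^sub>F t in nhds 0. u t \<in> real_matrices G)" if "finite J" for J
    using that
  proof induction
    case empty
    then show ?case
      using one_G by (intro exI[of _ "\<lambda>_. mat 1"]) (simp add: real_matrices_iff)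
  next
    case (insert k J)
    then obtain u :: "real^'d \<Rightarrow> complex^'n^'n" where u: "u 0 = mat 1"
      "\<And>i j. continuous_on UNIV (\<lambda>t. u t $ i $ j)"
      "\<And>i j. ((\<lambda>t. u t $ i $ j) has_derivative (\<lambda>h. \<Sum>k\<in>J. of_real (h $ k) * of_real (a k (i, j)))) (at 0)"
      "\<forall>\<^sub>F t in nhds 0. u t \<in> real_matrices G"
      by blast
    obtain \<gamma> :: "real \<Rightarrow> complex^'n^'n" where \<gamma>: "\<gamma> 0 = mat 1" "\<And>i j. continuous_on UNIV (\<lambda>t. \<gamma> t $ i $ j)"
      "\<And>i j. ((\<lambda>t. \<gamma> t $ i $ j) has_derivative (\<lambda>h. of_real h * of_real (a k (i, j)))) (at 0)"
      "\<forall>\<^sub>F t in nhds 0. \<gamma> t \<in> real_matrices G"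
      using real_curve_exists[OF a[of k]] by blast
    define w where "w t = u t ** \<gamma> (t $ k)" for t
    have w: "w t $ i $ j = (\<Sum>l\<in>UNIV. u t $ i $ l * \<gamma> (t $ k) $ l $ j)" for t i j
      by (simp add: w_def matrix_matrix_mult_def)
    have "continuous_on UNIV (\<lambda>t. w t $ i $ j)" for i j
    proof -
      have "continuous_on UNIV (\<lambda>t :: real^'d. \<gamma> (t $ k) $ l $ j)" for l j
        by (rule continuous_on_compose2[OF \<gamma>(2)]) (auto intro!: continuous_intros)
      then show ?thesis
        unfolding w by (intro continuous_on_sum continuous_on_mult u(2))
    qed
    moreover have "((\<lambda>t. w t $ i $ j) has_derivative
        (\<lambda>h. \<Sum>k\<in>insert k J. of_real (h $ k) * of_real (a k (i, j)))) (at 0)" for i j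
    proof -
      have g: "((\<lambda>t :: real^'d. \<gamma> (t $ k) $ l $ j) has_derivative (\<lambda>h. of_real (h $ k) * of_real (a k (l, j)))) (at 0)" for l
      proof -
        have "((\<lambda>t :: real^'d. t $ k) has_derivative (\<lambda>h. h $ k)) (at 0)"
          by (rule bounded_linear_imp_has_derivative) (rule bounded_linear_vec_nth)
        moreover have "((\<lambda>t. \<gamma> t $ l $ j) has_derivative (\<lambda>h. of_real h * of_real (a k (l, j))))
            (at ((0::real^'d) $ k))"
          using \<gamma>(3)[of l j] by simp
        ultimately show ?thesis by (rule has_derivative_compose)
      qed
      have "((\<lambda>t. w t $ i $ j) has_derivative
        (\<lambda>h. \<Sum>l\<in>UNIV. u 0 $ i $ l * (of_real (h $ k) * of_real (a k (l, j))) +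
           (\<Sum>k\<in>J. of_real (h $ k) * of_real (a k (i, l))) * \<gamma> ((0::real^'d) $ k) $ l $ j)) (at 0)"
        unfolding w by (intro has_derivative_sum has_derivative_mult u(3) g)
      moreover have "(\<Sum>l\<in>UNIV. u 0 $ i $ l * (of_real (h $ k) * of_real (a k (l, j))) +
           (\<Sum>k\<in>J. of_real (h $ k) * of_real (a k (i, l))) * \<gamma> ((0::real^'d) $ k) $ l $ j) =
           (\<Sum>k\<in>insert k J. of_real (h $ k) * of_real (a k (i, j)))" for h :: "real^'d"
        using insert(1,2)
        by (simp add: u(1) \<gamma>(1) mat_def sum.distrib if_distrib[of "\<lambda>x. x * _"]
            if_distrib[of "\<lambda>x. _ * x"] cong: if_cong)
      ultimately show ?thesis by simp
    qed
    moreover have "\<forall>\<^sub>F t in nhds (0::real^'d). w t \<in> real_matrices G"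
    proof -
      have "((\<lambda>t. t) \<longlongrightarrow> 0) (nhds (0::real^'d))" by (rule filterlim_ident)
      then have "((\<lambda>t :: real^'d. t $ k) \<longlongrightarrow> 0) (nhds 0)"
        using tendsto_vec_nth[of "\<lambda>t. t" "0::real^'d" "nhds 0" k] by simp
      then have "\<forall>\<^sub>F t in nhds (0::real^'d). \<gamma> (t $ k) \<in> real_matrices G"
        using \<gamma>(4) by (auto simp: filterlim_iff)
      with u(4) show ?thesis
      proof eventually_elim
        case (elim t)
        then show ?case by (simp add: w_def real_matrices_iff mult_G cnj_matrix_mult)
      qed
    qed
    ultimately show ?case
      by (intro exI[of _ w]) (simp add: w_def u(1) \<gamma>(1))
  qed
  from this[of UNIV] show ?thesis by simp
qed

end

section \<open>The inverse function argument\<close>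

definition real_part :: "complex^'d \<Rightarrow> real^'d" where
  "real_part y = (\<chi> k. Re (y $ k))"

definition complexify :: "real^'d \<Rightarrow> 'd \<Rightarrow> complex" where
  "complexify v = (\<lambda>k. of_real (v $ k))"

text \<open>
The gradient, as a vector of \<open>\<real>\<^sup>d\<close>. For polynomials that are real on real points it
determines all derivatives at such points.
\<close>
definition grad :: "'d::finite cpoly \<Rightarrow> ('d \<Rightarrow> complex) \<Rightarrow> real^'d" where
  "grad p z = (\<chi> k. Re (pdiff p z (complexify (axis k 1))))"

lemma cnj_complexify [simp]: "cnj (complexify v k) = complexify v k"
  by (simp add: complexify_def)

lemma complexify_real_part: "(\<And>k. cnj (y $ k) = y $ k) \<Longrightarrow> complexify (real_part y) = ($) y"
  by (auto simp: complexify_def real_part_def fun_eq_iff complex_eq_iff)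

lemma complexify_expansion:
  "complexify v = (\<lambda>k. \<Sum>i\<in>UNIV. of_real (v $ i) * complexify (axis i 1) k)"
  by (auto simp: complexify_def axis_def fun_eq_iff if_distrib[of of_real]
      if_distrib[of "\<lambda>x. _ * x"] cong: if_cong)

lemma Re_pdiff_complexify: "Re (pdiff p z (complexify v)) = grad p z \<bullet> v"
proof -
  have "pdiff p z (complexify v) = (\<Sum>i\<in>UNIV. of_real (v $ i) * pdiff p z (complexify (axis i 1)))"
    by (subst complexify_expansion) (rule pdiff_sum_right)
  then show ?thesis
    by (simp add: grad_def inner_vec_def mult.commute)
qed

lemma pdiff_real_function:
  assumes "real_function p" "\<And>k. cnj (z k) = z k"
  shows "pdiff p z (complexify v) = of_real (grad p z \<bullet> v)"
  using real_function_pdiff[OF assms(1), of z "complexify v"] assms(2)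
  by (simp add: complex_eq_iff Re_pdiff_complexify[symmetric])

text \<open>
The differential of a polynomial map is continuous, so a map whose differential at a point is the
identity is injective near it.
\<close>
lemma polynomial_map_locally_injective:
  fixes L :: "real^'d::finite \<Rightarrow> real^'d" and p :: "'d \<Rightarrow> 'd cpoly"
  assumes L: "linear L" and id: "\<And>v. L v + (\<chi> j. grad (p j) (complexify x0) \<bullet> v) = v"
  shows "\<exists>r>0. inj_on (\<lambda>y. L y + (\<chi> j. Re (peval (p j) (complexify y)))) (ball x0 r)"
proof -
  define f where "f y = L y + (\<chi> j. Re (peval (p j) (complexify y)))" for y
  define f' where "f' y v = L v + (\<chi> j. grad (p j) (complexify y) \<bullet> v)" for y v
  have f: "(f has_derivative f' y) (at y)" for y
  proof -
    have "((\<lambda>y. complexify y k) has_derivative (\<lambda>h. complexify h k)) (at y)" for k :: 'd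
      unfolding complexify_def
      by (intro bounded_linear_imp_has_derivative bounded_linear_compose[OF bounded_linear_of_real]
          bounded_linear_vec_nth)
    then have "((\<lambda>y. peval (p j) (complexify y)) has_derivative
        (\<lambda>h. pdiff (p j) (complexify y) (complexify h))) (at y)" for j
      using has_derivative_peval[of complexify "\<lambda>k h. complexify h k" y "p j"] by simp
    then have "((\<lambda>y. Re (peval (p j) (complexify y))) has_derivative
        (\<lambda>h. grad (p j) (complexify y) \<bullet> h)) (at y)" for j
      unfolding Re_pdiff_complexify[symmetric] by (rule bounded_linear.has_derivative[OF bounded_linear_Re])
    then show ?thesis
      unfolding f_def[abs_def] f'_def[abs_def]
      by (intro has_derivative_add has_derivative_vec_lambda linear_imp_has_derivative L)
  qed
  define b where "b y = (\<Sum>j\<in>UNIV. norm (grad (p j) (complexify y) - grad (p j) (complexify x0)))" for y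
  have "continuous_on UNIV (\<lambda>y. grad (p j) (complexify y))" for j
  proof -
    have "continuous_on UNIV (\<lambda>y. pdiff (p j) (complexify y) (complexify (axis k 1)))" for k
    proof -
      obtain r where r: "\<And>z. peval r z = pdiff (p j) z (\<lambda>v. peval (cconst (complexify (axis k 1) v)) z)"
        using pdiff_field_poly_exists[of "p j" "\<lambda>v. cconst (complexify (axis k 1) v)"] by blast
      then have "peval r z = pdiff (p j) z (complexify (axis k 1))" for z
        by simp
      moreover have "continuous_on UNIV (\<lambda>y :: real^'d. peval r (complexify y))"
        unfolding complexify_def by (intro continuous_on_peval continuous_intros)
      ultimately show ?thesis by simp
    qed
    then show ?thesis unfolding grad_def by (intro continuous_intros)
  qed
  then have b_cont: "continuous_on UNIV b"
    unfolding b_def by (intro continuous_intros)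
  have bound: "onorm (\<lambda>v. f' y v - f' x0 v) \<le> b y" for y
  proof (rule onorm_le)
    fix v
    have "norm (f' y v - f' x0 v) \<le> (\<Sum>j\<in>UNIV. \<bar>(f' y v - f' x0 v) $ j\<bar>)"
      by (rule norm_le_l1_cart)
    also have "\<dots> \<le> (\<Sum>j\<in>UNIV. norm (grad (p j) (complexify y) - grad (p j) (complexify x0)) * norm v)"
    proof (rule sum_mono)
      fix j
      have "(f' y v - f' x0 v) $ j = (grad (p j) (complexify y) - grad (p j) (complexify x0)) \<bullet> v"
        by (simp add: f'_def inner_diff_left)
      then show "\<bar>(f' y v - f' x0 v) $ j\<bar> \<le>
          norm (grad (p j) (complexify y) - grad (p j) (complexify x0)) * norm v"
        using Cauchy_Schwarz_ineq2 by simp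
    qed
    finally show "norm (f' y v - f' x0 v) \<le> b y * norm v" by (simp add: b_def sum_distrib_right)
  qed
  obtain r where "r > 0" "ball x0 r \<subseteq> UNIV" "inj_on f (ball x0 r)"
  proof (rule has_derivative_locally_injective[of x0 UNIV id f' f])
    fix e :: real assume "e > 0"
    have "b x0 = 0" by (simp add: b_def)
    then obtain d where "d > 0" and d: "\<And>y. dist y x0 < d \<Longrightarrow> dist (b y) 0 < e"
      using b_cont \<open>e > 0\<close> unfolding continuous_on_iff by (metis UNIV_I)
    show "\<exists>d>0. \<forall>y. dist x0 y < d \<longrightarrow> onorm (\<lambda>v. f' y v - f' x0 v) < e"
    proof (intro exI[of _ d] conjI allI impI)
      fix y assume "dist x0 y < d"
      then have "b y < e" using d[of y] by (simp add: dist_commute)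
      then show "onorm (\<lambda>v. f' y v - f' x0 v) < e" using bound[of y] by linarith
    qed fact
  qed (use f id in \<open>auto simp: f'_def fun_eq_iff id_def bounded_linear_ident\<close>)
  then show ?thesis unfolding f_def by blast
qed

context real_orbit begin

definition Y_real :: "(complex^'d) set" where
  "Y_real = {y. (\<forall>k. cnj (y $ k) = y $ k) \<and> (\<forall>p\<in>IY. peval p (($) y) = 0)}"

text \<open>
The gradients at \<open>x\<close> of real equations of the orbit form a subspace \<open>W\<close> of \<open>\<real>\<^sup>d\<close> with orthogonal
complement the real tangent space of \<open>Y\<close>. If \<open>q j\<close> has as gradient the orthogonal projection \<open>a j\<close> of
the \<open>j\<close>-th unit vector to \<open>W\<close>, then the differential of the map \<open>q\<close> is the orthogonal projection to
\<open>W\<close>, so subtracting it from \<open>v\<close> leaves a tangent vector.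
\<close>
lemma tangent_projection_exists:
  "\<exists>q :: 'd \<Rightarrow> 'd cpoly. (\<forall>j. q j \<in> IY) \<and>
    (\<forall>p v. p \<in> IY \<longrightarrow> real_function p \<longrightarrow>
      grad p (($) x) \<bullet> (v - (\<chi> j. grad (q j) (($) x) \<bullet> v)) = 0) \<and> (\<forall>j. real_function (q j))"
proof -
  define W where "W = {grad p (($) x) | p. p \<in> IY \<and> real_function p}"
  have "subspace W"
  proof (rule subspaceI)
    have "grad 0 (($) x) = 0" "0 \<in> IY" "real_function 0"
      by (simp_all add: grad_def vec_eq_iff IY_iff real_function_def)
    then show "0 \<in> W" unfolding W_def by (metis (mono_tags, lifting) mem_Collect_eq)
    fix a b assume "a \<in> W" "b \<in> W"
    then obtain p r where "p \<in> IY" "real_function p" "a = grad p (($) x)"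
      "r \<in> IY" "real_function r" "b = grad r (($) x)" by (auto simp: W_def)
    then have "p + r \<in> IY" "real_function (p + r)" "a + b = grad (p + r) (($) x)"
      by (simp_all add: IY_iff real_function_def peval_add grad_def pdiff_add vec_eq_iff)
    then show "a + b \<in> W" unfolding W_def by blast
  next
    fix c and a :: "real^'d" assume "a \<in> W"
    then obtain p where "p \<in> IY" "real_function p" "a = grad p (($) x)" by (auto simp: W_def)
    then have "cconst (of_real c) * p \<in> IY" "real_function (cconst (of_real c) * p)"
      "c *\<^sub>R a = grad (cconst (of_real c) * p) (($) x)"
      by (simp_all add: IY_iff real_function_def peval_mult grad_def pdiff_mult vec_eq_iff)
    then show "c *\<^sub>R a \<in> W" unfolding W_def by blast
  qed
  then have span: "span W = W" by (rule span_eq_iff[THEN iffD2])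
  have "\<exists>a. a \<in> W \<and> (\<forall>w\<in>W. (axis j 1 - a) \<bullet> w = 0)" for j :: 'd
  proof -
    obtain a b where "a \<in> span W" "\<And>w. w \<in> span W \<Longrightarrow> orthogonal b w" "axis j 1 = a + b"
      by (rule orthogonal_subspace_decomp_exists[where S = W and x = "axis j 1"]) blast
    then show ?thesis by (intro exI[of _ a]) (auto simp: span orthogonal_def)
  qed
  then obtain a :: "'d \<Rightarrow> real^'d" where a: "\<And>j. a j \<in> W" "\<And>j w. w \<in> W \<Longrightarrow> (axis j 1 - a j) \<bullet> w = 0"
    by metis
  have "\<forall>j. \<exists>p. p \<in> IY \<and> real_function p \<and> a j = grad p (($) x)"
    using a(1) unfolding W_def by blast
  then obtain q where q: "\<And>j. q j \<in> IY" "\<And>j. real_function (q j)" "\<And>j. a j = grad (q j) (($) x)"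
    by metis
  have "w \<bullet> (v - (\<chi> j. a j \<bullet> v)) = 0" if w: "w \<in> W" for w v
  proof -
    define s where "s = (\<Sum>j\<in>UNIV. (w $ j) *\<^sub>R a j)"
    have "s \<in> W" unfolding s_def by (intro subspace_sum subspace_scale \<open>subspace W\<close> a)
    \<comment> \<open>\<open>w - s\<close> lies in \<open>W\<close> and, by this formula, in its orthogonal complement.\<close>
    have ws: "w - s = (\<Sum>j\<in>UNIV. (w $ j) *\<^sub>R (axis j 1 - a j))"
      using basis_expansion[of w] by (simp add: s_def scaleR_diff_right sum_subtractf scalar_mult_eq_scaleR)
    have "(w - s) \<bullet> (w - s) = 0"
      using subspace_diff[OF \<open>subspace W\<close> w \<open>s \<in> W\<close>] a(2)
      by (subst (1) ws) (simp add: inner_sum_left)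
    then have "w = s" by simp
    moreover have "s \<bullet> v = (\<Sum>j\<in>UNIV. w $ j * (a j \<bullet> v))"
      unfolding s_def by (simp add: inner_sum_left)
    ultimately have "w \<bullet> v = (\<Sum>j\<in>UNIV. w $ j * (a j \<bullet> v))" by simp
    then show ?thesis by (simp add: inner_diff_right inner_vec_def[of w "\<chi> j. a j \<bullet> v"])
  qed
  then show ?thesis
    using q unfolding W_def by (intro exI[of _ q]) auto
qed

text \<open>
Let \<open>N\<close> be the differential at \<open>x\<close> of the system \<open>q\<close> of equations of \<open>Y\<close> and \<open>\<pi> = 1 - N\<close> the
projection to the tangent space. The map \<open>\<Phi> t = u t \<cdot> x\<close> has differential \<open>\<pi>\<close> at \<open>0\<close>, so
\<open>\<Psi> t = \<pi> (\<Phi> t - x) + N t\<close> has differential \<open>\<pi> \<pi> + N = 1\<close> and is open at \<open>0\<close>. Given \<open>y \<in> Y(\<real>)\<close>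
near \<open>x\<close>, solve \<open>\<Psi> t = \<pi> (y - x)\<close>; then \<open>N t = 0\<close> and \<open>\<pi> (\<Phi> t) = \<pi> y\<close>. Both \<open>\<Phi> t\<close> and \<open>y\<close>
satisfy \<open>q = 0\<close>, and \<open>\<pi> + q\<close> has differential \<open>1\<close> and is injective near \<open>x\<close>, so \<open>\<Phi> t = y\<close>.
\<close>
lemma orbit_map_locally_open:
  assumes "\<epsilon> > 0"
  shows "\<exists>\<delta>>0. \<forall>y\<in>Y_real. dist y x < \<delta> \<longrightarrow>
    (\<exists>u\<in>real_matrices G. dist u (mat 1) < \<epsilon> \<and> act u x = y)"
proof -
  obtain q :: "'d \<Rightarrow> 'd cpoly" where q: "\<And>j. q j \<in> IY" "\<And>j. real_function (q j)"
    and orth: "\<And>p v. p \<in> IY \<Longrightarrow> real_function p \<Longrightarrow>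
      grad p (($) x) \<bullet> (v - (\<chi> j. grad (q j) (($) x) \<bullet> v)) = 0"
    using tangent_projection_exists by blast
  define N :: "real^'d \<Rightarrow> real^'d" where "N v = (\<chi> j. grad (q j) (($) x) \<bullet> v)" for v
  define \<pi> where "\<pi> v = v - N v" for v
  have N_lin: "linear N"
    by (rule linearI) (simp_all add: N_def inner_add_right vec_eq_iff)
  then have \<pi>_lin: "linear \<pi>"
    unfolding \<pi>_def[abs_def] by (intro linear_compose_sub linear_ident)
  have N\<pi>: "N (\<pi> v) = 0" for v
    using orth[OF q] by (simp add: N_def \<pi>_def vec_eq_iff)
  have \<pi>\<pi>: "\<pi> (\<pi> v) = \<pi> v" for v
    using N\<pi>[of v] by (simp add: \<pi>_def[of "\<pi> v"])
  define x0 where "x0 = real_part x"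
  have x0: "complexify x0 = ($) x"
    unfolding x0_def by (rule complexify_real_part) (rule x_real)
  have "\<exists>a :: 'n \<times> 'n \<Rightarrow> real. (\<lambda>ij. of_real (a ij)) \<in> tangent_G \<and>
    (\<forall>k. pdiff (orbit_poly k) (coords (mat 1)) (\<lambda>ij. of_real (a ij)) = of_real (\<pi> (axis j 1) $ k))" for j
  proof (rule real_orbit_differential_surj)
    fix p assume "p \<in> IY" "real_function p"
    then have "pdiff p (($) x) (complexify (\<pi> (axis j 1))) = 0"
      using pdiff_real_function[of p "($) x"] orth[of p "axis j 1"] x_real
      by (simp add: \<pi>_def N_def)
    then show "pdiff p (($) x) (\<lambda>k. of_real (\<pi> (axis j 1) $ k)) = 0"
      by (simp add: complexify_def)
  qed
  then obtain a :: "'d \<Rightarrow> 'n \<times> 'n \<Rightarrow> real" where a: "\<And>j. (\<lambda>ij. of_real (a j ij)) \<in> tangent_G"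
    and df: "\<And>j k. pdiff (orbit_poly k) (coords (mat 1)) (\<lambda>ij. of_real (a j ij)) = of_real (\<pi> (axis j 1) $ k)"
    by metis
  obtain u :: "real^'d \<Rightarrow> complex^'n^'n" where u0: "u 0 = mat 1"
    and u_cont: "\<And>i j. continuous_on UNIV (\<lambda>t. u t $ i $ j)"
    and u': "\<And>i j. ((\<lambda>t. u t $ i $ j) has_derivative (\<lambda>h. \<Sum>k\<in>UNIV. of_real (h $ k) * of_real (a k (i, j)))) (at 0)"
    and u_G: "\<forall>\<^sub>F t in nhds 0. u t \<in> real_matrices G"
    using real_chart_exists[of a, OF a] by blast
  define \<Phi> where "\<Phi> t = (\<chi> k. Re (peval (orbit_poly k) (coords (u t))))" for t
  have coords_cont: "continuous_on UNIV (\<lambda>t. coords (u t) ij)" for ij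
    using u_cont by (cases ij) simp
  have \<Phi>_cont: "continuous_on UNIV \<Phi>"
    unfolding \<Phi>_def[abs_def] by (intro continuous_intros continuous_on_peval coords_cont)
  have \<pi>_sum: "(\<Sum>j\<in>UNIV. (h $ j) *\<^sub>R \<pi> (axis j 1)) = \<pi> h" for h
  proof -
    have "h = (\<Sum>j\<in>UNIV. (h $ j) *\<^sub>R axis j 1)"
      using basis_expansion[of h] by (simp add: scalar_mult_eq_scaleR)
    then have "\<pi> h = \<pi> (\<Sum>j\<in>UNIV. (h $ j) *\<^sub>R axis j 1)" by (rule arg_cong)
    then show ?thesis
      unfolding linear_sum[OF \<pi>_lin] linear_cmul[OF \<pi>_lin] ..
  qed
  have \<Phi>': "(\<Phi> has_derivative \<pi>) (at 0)"
  proof -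
    have "((\<lambda>t. coords (u t) ij) has_derivative (\<lambda>h. \<Sum>j\<in>UNIV. of_real (h $ j) * of_real (a j ij))) (at 0)" for ij
      using u' by (cases ij) simp
    note coords_u' = this
    have "pdiff (orbit_poly k) (coords (u 0)) (\<lambda>ij. \<Sum>j\<in>UNIV. of_real (h $ j) * of_real (a j ij)) =
        of_real (\<pi> h $ k)" for h k
      unfolding pdiff_sum_right u0 df by (subst \<pi>_sum[of h, symmetric]) simp
    then have "((\<lambda>t. peval (orbit_poly k) (coords (u t))) has_derivative
        (\<lambda>h. of_real (\<pi> h $ k))) (at 0)" for k
      using has_derivative_peval[of "\<lambda>t. coords (u t)", OF coords_u', of "orbit_poly k"] by simp
    then have "((\<lambda>t. Re (peval (orbit_poly k) (coords (u t)))) has_derivative (\<lambda>h. \<pi> h $ k)) (at 0)" for k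
      using bounded_linear.has_derivative[OF bounded_linear_Re] by fastforce
    then have "(\<Phi> has_derivative (\<lambda>h. \<chi> k. \<pi> h $ k)) (at 0)"
      unfolding \<Phi>_def[abs_def] by (rule has_derivative_vec_lambda)
    then show ?thesis by simp
  qed
  have \<Phi>_act: "complexify (\<Phi> t) = ($) (act (u t) x)" if "u t \<in> real_matrices G" for t
  proof -
    have t: "u t \<in> G" "cnj_matrix (u t) = u t" using that by (auto simp: real_matrices_iff)
    then have "\<Phi> t = real_part (act (u t) x)"
      by (simp add: \<Phi>_def real_part_def peval_orbit_poly)
    then show ?thesis
      using cnj_act_x[OF t(1)] t(2) by (simp add: complexify_real_part)
  qed
  have \<Phi>0: "\<Phi> 0 = x0"
    using one_G act_one[OF x_in_X] by (simp add: \<Phi>_def x0_def real_part_def u0 peval_orbit_poly)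
  obtain r where "r > 0" and inj: "inj_on (\<lambda>y. \<pi> y + (\<chi> j. Re (peval (q j) (complexify y)))) (ball x0 r)"
    using polynomial_map_locally_injective[OF \<pi>_lin, of q x0]
    unfolding x0 by (auto simp: \<pi>_def N_def)
  have "\<forall>\<^sub>F t in nhds 0. u t \<in> real_matrices G \<and> dist (u t) (mat 1) < \<epsilon> \<and> \<Phi> t \<in> ball x0 r"
  proof (intro eventually_conj u_G)
    have "continuous_on UNIV (\<lambda>t. \<chi> i j. u t $ i $ j)" by (intro continuous_intros u_cont)
    then have "(u \<longlongrightarrow> u 0) (nhds 0)"
      by (simp add: continuous_on_eq_continuous_at isCont_def tendsto_at_iff_tendsto_nhds)
    then show "\<forall>\<^sub>F t in nhds 0. dist (u t) (mat 1) < \<epsilon>"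
      unfolding u0 using \<open>\<epsilon> > 0\<close> by (rule tendstoD)
    have "(\<Phi> \<longlongrightarrow> \<Phi> 0) (nhds 0)"
      using \<Phi>_cont by (simp add: continuous_on_eq_continuous_at isCont_def tendsto_at_iff_tendsto_nhds)
    then show "\<forall>\<^sub>F t in nhds 0. \<Phi> t \<in> ball x0 r"
      unfolding \<Phi>0 using tendstoD[of \<Phi> x0 "nhds 0" r] \<open>r > 0\<close> by (simp add: dist_commute)
  qed
  then obtain s where "s > 0" and s: "\<And>t. t \<in> ball 0 s \<Longrightarrow>
      u t \<in> real_matrices G \<and> dist (u t) (mat 1) < \<epsilon> \<and> \<Phi> t \<in> ball x0 r"
    unfolding eventually_nhds_metric by (auto simp: dist_commute)
  define \<Psi> where "\<Psi> t = \<pi> (\<Phi> t - x0) + N t" for t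
  have "\<Psi> 0 \<in> interior (\<Psi> ` ball 0 s)"
  proof (rule sussmann_open_mapping[of UNIV \<Psi> 0 id id])
    show "continuous_on UNIV \<Psi>"
      unfolding \<Psi>_def[abs_def]
      by (intro continuous_on_add linear_continuous_on linear_conv_bounded_linear[THEN iffD1] N_lin
          continuous_on_compose2[OF linear_continuous_on[OF linear_conv_bounded_linear[THEN iffD1, OF \<pi>_lin]]]
          continuous_on_diff \<Phi>_cont continuous_on_const) auto
    have "((\<lambda>t. \<Phi> t - x0) has_derivative \<pi>) (at 0)"
      using has_derivative_diff[OF \<Phi>' has_derivative_const] by simp
    from bounded_linear.has_derivative[OF linear_conv_bounded_linear[THEN iffD1, OF \<pi>_lin] this]
    have "(\<Psi> has_derivative (\<lambda>h. \<pi> (\<pi> h) + N h)) (at 0)"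
      unfolding \<Psi>_def[abs_def] by (intro has_derivative_add linear_imp_has_derivative N_lin)
    moreover have "\<pi> (\<pi> h) + N h = h" for h
      unfolding \<pi>\<pi> by (simp add: \<pi>_def)
    ultimately show "(\<Psi> has_derivative id) (at 0)"
      by (simp add: id_def)
  qed (use \<open>s > 0\<close> in \<open>auto simp: interior_open bounded_linear_ident[unfolded id_def[symmetric]]\<close>)
  moreover have "\<Psi> 0 = 0"
    by (simp add: \<Psi>_def \<Phi>0 linear_0[OF N_lin] linear_0[OF \<pi>_lin])
  ultimately obtain \<rho> where "\<rho> > 0" and \<rho>: "ball 0 \<rho> \<subseteq> \<Psi> ` ball 0 s"
    unfolding mem_interior by auto
  have near: "\<forall>\<^sub>F y in nhds x. norm (\<pi> (real_part y - x0)) < \<rho> \<and> real_part y \<in> ball x0 r"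
  proof -
    have rp: "(real_part \<longlongrightarrow> x0) (nhds x)"
      unfolding real_part_def[abs_def] x0_def by (intro tendsto_intros filterlim_ident)
    then have "((\<lambda>y. \<pi> (real_part y - x0)) \<longlongrightarrow> \<pi> (x0 - x0)) (nhds x)"
      by (intro bounded_linear.tendsto[OF linear_conv_bounded_linear[THEN iffD1, OF \<pi>_lin]] tendsto_intros)
    then have "\<forall>\<^sub>F y in nhds x. dist (\<pi> (real_part y - x0)) (\<pi> (x0 - x0)) < \<rho>"
      using \<open>\<rho> > 0\<close> by (rule tendstoD)
    moreover have "\<forall>\<^sub>F y in nhds x. dist (real_part y) x0 < r"
      using rp \<open>r > 0\<close> by (rule tendstoD)
    ultimately show ?thesis
      by eventually_elim (simp add: linear_0[OF \<pi>_lin] dist_commute)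
  qed
  then obtain \<delta> where "\<delta> > 0" and \<delta>: "\<And>y. dist y x < \<delta> \<Longrightarrow>
      norm (\<pi> (real_part y - x0)) < \<rho> \<and> real_part y \<in> ball x0 r"
    unfolding eventually_nhds_metric by blast
  show ?thesis
  proof (intro exI[of _ \<delta>] conjI ballI impI \<open>\<delta> > 0\<close>)
    fix y assume y: "y \<in> Y_real" "dist y x < \<delta>"
    have cy: "complexify (real_part y) = ($) y"
      using y(1) by (intro complexify_real_part) (simp add: Y_real_def)
    have "\<pi> (real_part y - x0) \<in> ball 0 \<rho>" using \<delta>[OF y(2)] by simp
    then obtain t where t: "t \<in> ball 0 s" "\<pi> (real_part y - x0) = \<pi> (\<Phi> t - x0) + N t"
      using \<rho> unfolding \<Psi>_def by blast
    have ut: "u t \<in> real_matrices G" "dist (u t) (mat 1) < \<epsilon>" "\<Phi> t \<in> ball x0 r"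
      using s[OF t(1)] by auto
    have "N (N t) = N t"
      using N\<pi>[of t] by (simp add: \<pi>_def linear_diff[OF N_lin])
    then have "N t = 0"
      using arg_cong[OF t(2), of N] by (simp add: linear_add[OF N_lin] N\<pi>)
    then have "\<pi> (real_part y) = \<pi> (\<Phi> t)"
      using t(2) by (simp add: linear_diff[OF \<pi>_lin])
    moreover have "peval (q j) (complexify (\<Phi> t)) = 0" for j
      using q(1)[of j] ut(1) by (auto simp: \<Phi>_act IY_iff real_matrices_iff)
    moreover have "peval (q j) (complexify (real_part y)) = 0" for j
      using q(1)[of j] y(1) by (simp add: cy Y_real_def)
    ultimately have "\<Phi> t = real_part y"
      using inj_onD[OF inj, of "\<Phi> t" "real_part y"] ut(3) \<delta>[OF y(2)] by simp
    then have "act (u t) x = y"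
      using \<Phi>_act[OF ut(1)] cy by (metis vec_nth_inject)
    then show "\<exists>u\<in>real_matrices G. dist u (mat 1) < \<epsilon> \<and> act u x = y"
      using ut by blast
  qed
qed

lemma cnj_act:
  fixes y :: "complex^'d"
  assumes "g \<in> G" "y \<in> X" "\<And>k. cnj (y $ k) = y $ k"
  shows "cnj (act g y $ k) = act (cnj_matrix g) y $ k"
proof -
  have "(\<lambda>v. cnj (case_sum (($) (entries g)) (($) y) v)) = case_sum (($) (entries (cnj_matrix g))) (($) y)"
    using coords_cnj_matrix[of g] assms(3) by (auto simp: fun_eq_iff coords_def split: sum.split)
  then show ?thesis
    using real_function_real_cpoly[OF P_real[of k]] act_eq[OF assms(1,2)]
      act_eq[OF cnj_matrix_G[OF assms(1)] assms(2)]
    by (metis real_function_def)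
qed

lemma Y_real_translate:
  assumes "g \<in> real_matrices G" "y \<in> Y_real" "y \<in> X"
  shows "act g y \<in> Y_real"
proof -
  have g: "g \<in> G" "cnj_matrix g = g" using assms(1) by (auto simp: real_matrices_iff)
  have "cnj (act g y $ k) = act g y $ k" for k
    using cnj_act[OF g(1) assms(3)] assms(2) g(2) by (simp add: Y_real_def)
  moreover have "peval p (($) (act g y)) = 0" if "p \<in> IY" for p
  proof -
    have "peval (psubst (act_poly g) p) (($) y) = 0"
      using assms(2) IY_translate[OF g(1) that] unfolding Y_real_def by blast
    then show ?thesis by (simp add: peval_act_poly' g(1) assms(3))
  qed
  ultimately show ?thesis by (simp add: Y_real_def)
qed

lemma real_inverse:
  assumes "g \<in> real_matrices G"
  obtains h where "h \<in> real_matrices G" "h ** g = mat 1" "g ** h = mat 1"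
proof -
  have g: "g \<in> G" "cnj_matrix g = g" using assms by (auto simp: real_matrices_iff)
  obtain h where h: "h \<in> G" "h ** g = mat 1" "g ** h = mat 1" by (rule inverse_G[OF g(1)])
  have "cnj_matrix h ** g = mat 1"
    using cnj_matrix_mult[of h g] h(2) g(2) by simp
  then have "cnj_matrix h = h"
    using h(3) by (metis matrix_mul_assoc matrix_mul_lid matrix_mul_rid)
  then have "h \<in> real_matrices G" using h(1) by (simp add: real_matrices_iff)
  with h show ?thesis using that by blast
qed

text \<open>
Near \<open>g \<cdot> x\<close> the inverse of \<open>g\<close> maps \<open>Y(\<real>)\<close> continuously to a neighbourhood of \<open>x\<close>, where the
local statement applies; multiplying by \<open>g\<close> carries the solution back.
\<close>
lemma orbit_map_open:
  assumes U: "openin (top_of_set (real_matrices G)) U" and Z: "Z \<subseteq> Y_real \<inter> X"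
    and orb: "\<And>g. g \<in> real_matrices G \<Longrightarrow> act g x \<in> Z"
  shows "openin (top_of_set Z) ((\<lambda>g. act g x) ` U)"
  unfolding openin_euclidean_subtopology_iff
proof (intro conjI ballI)
  have U_sub: "U \<subseteq> real_matrices G" using openin_subset[OF U] by simp
  then show "(\<lambda>g. act g x) ` U \<subseteq> Z" using orb by blast
  fix z assume "z \<in> (\<lambda>g. act g x) ` U"
  then obtain g where g: "g \<in> U" "z = act g x" by blast
  then have gR: "g \<in> real_matrices G" and gG: "g \<in> G" using U_sub by (auto simp: real_matrices_iff)
  obtain e where "e > 0" and e: "\<And>g'. g' \<in> real_matrices G \<Longrightarrow> dist g' g < e \<Longrightarrow> g' \<in> U"
    using U g(1) unfolding openin_euclidean_subtopology_iff by blast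
  obtain h where h: "h \<in> real_matrices G" "h ** g = mat 1" "g ** h = mat 1"
    by (rule real_inverse[OF gR])
  then have hG: "h \<in> G" by (simp add: real_matrices_iff)
  have "continuous_on UNIV (\<lambda>u :: complex^'n^'n. g ** u)"
    unfolding matrix_matrix_mult_def by (intro continuous_intros)
  then obtain \<epsilon> where "\<epsilon> > 0" and \<epsilon>: "\<And>u. dist u (mat 1) < \<epsilon> \<Longrightarrow> dist (g ** u) (g ** mat 1) < e"
    using \<open>e > 0\<close> unfolding continuous_on_iff by (metis UNIV_I)
  obtain \<delta> where "\<delta> > 0" and \<delta>: "\<And>y. y \<in> Y_real \<Longrightarrow> dist y x < \<delta> \<Longrightarrow>
      \<exists>u\<in>real_matrices G. dist u (mat 1) < \<epsilon> \<and> act u x = y"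
    using orbit_map_locally_open[OF \<open>\<epsilon> > 0\<close>] by blast
  define H where "H y = (\<chi> k. peval (act_poly h k) (($) y))" for y
  have H: "H y = act h y" if "y \<in> X" for y
    using that by (simp add: H_def vec_eq_iff peval_act_poly hG)
  have zX: "z \<in> X" using g gG by (simp add: act_X x_in_X)
  have "H z = x"
    using H[OF zX] g(2) act_orb[OF hG gG] h(2) act_one[OF x_in_X] by simp
  have "continuous_on UNIV H"
    unfolding H_def[abs_def] by (intro continuous_intros continuous_on_peval)
  then obtain d where "d > 0" and d: "\<And>y. dist y z < d \<Longrightarrow> dist (H y) x < \<delta>"
    using \<open>\<delta> > 0\<close> \<open>H z = x\<close> unfolding continuous_on_iff by (metis UNIV_I)
  show "\<exists>d>0. \<forall>y\<in>Z. dist y z < d \<longrightarrow> y \<in> (\<lambda>g. act g x) ` U"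
  proof (intro exI[of _ d] conjI ballI impI \<open>d > 0\<close>)
    fix y assume "y \<in> Z" "dist y z < d"
    then have y: "y \<in> Y_real" "y \<in> X" "dist (act h y) x < \<delta>" using Z d[of y] H[of y] by auto
    then obtain u where u: "u \<in> real_matrices G" "dist u (mat 1) < \<epsilon>" "act u x = act h y"
      using \<delta>[of "act h y"] Y_real_translate[OF h(1)] by blast
    have uG: "u \<in> G" using u(1) by (simp add: real_matrices_iff)
    have "act (g ** u) x = act g (act h y)"
      using u(3) by (simp add: act_mult gG uG x_in_X)
    also have "\<dots> = y"
      using act_mult[OF gG hG y(2)] act_one[OF y(2)] h(3) by simp
    finally have "act (g ** u) x = y" .
    moreover have "g ** u \<in> real_matrices G"
      using gR u(1) by (simp add: real_matrices_iff mult_G cnj_matrix_mult)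
    then have "g ** u \<in> U" using e \<epsilon>[OF u(2)] by simp
    ultimately show "y \<in> (\<lambda>g. act g x) ` U" by blast
  qed
qed

end

theorem theorem4p9:
  fixes G :: "(complex^'n::finite^'n) set"
    and X :: "(complex^'d::finite) set"
    and act :: "complex^'n^'n \<Rightarrow> complex^'d \<Rightarrow> complex^'d"
    and x :: "complex^'d"
    and Y :: "(complex^'d) set"
  assumes "algebraic_group G"
    and "zariski_irreducible (entries ` G)"
    and "defined_over_reals (entries ` G)"
    and "zariski_closed X"
    and "defined_over_reals X"
    and "x \<in> real_points X"
    and "real_polynomial_action G X act"
    and "Y = subtopology zariski_topology X closure_of orbit (GL\<lparr>carrier := G\<rparr>) act x"
  shows "open_map (top_of_set (real_matrices G)) (top_of_set (real_points Y)) (\<lambda>g. act g x)"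
proof -
  obtain P where P: "\<forall>k. real_cpoly (P k)"
    "\<forall>g\<in>G. \<forall>y\<in>X. \<forall>k. act g y $ k = peval (P k) (case_sum (($) (entries g)) (($) y))"
    and action: "group_action (GL\<lparr>carrier := G\<rparr>) X act"
    using assms(7) unfolding real_polynomial_action_def by blast
  interpret real_orbit G X act x P
    by (rule real_orbit.intro) (use assms action P in auto)
  have orb: "orbit (GL\<lparr>carrier := G\<rparr>) act x = orb"
    by (auto simp: orbit_def)
  have orb_X: "orb \<subseteq> X" using act_X x_in_X by blast
  have "Y \<subseteq> X" unfolding assms(8) using closure_of_subset_topspace by fastforce
  have "orb \<subseteq> Y"
    unfolding assms(8) orb by (rule closure_of_subset) (use orb_X in simp)
  have "closedin (subtopology zariski_topology X) (X \<inter> zero_set IY)"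
    by (auto simp: closedin_subtopology closedin_zariski zariski_closed_def)
  then have "Y \<subseteq> X \<inter> zero_set IY"
    unfolding assms(8) orb
    by (rule closure_of_minimal[rotated]) (use orb_X in \<open>auto simp: zero_set_def IY_iff\<close>)
  then have Z: "real_points Y \<subseteq> Y_real \<inter> X"
    by (auto simp: real_points_def Y_real_def zero_set_def Reals_cnj_iff)
  have "act g x \<in> real_points Y" if "g \<in> real_matrices G" for g
    using that \<open>orb \<subseteq> Y\<close> cnj_act_x[of g]
    by (auto simp: real_points_def real_matrices_iff Reals_cnj_iff)
  then show ?thesis
    unfolding open_map_def using orbit_map_open[OF _ Z] by blast
qed

end
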